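(* Let $\mathfrak h$ be a finite-dimensional abelian Lie algebra over $\mathbb{C}$ with nondegenerate symmetric bilinear form, $d=\dim\mathfrak h$. Given a highest weight $\hat{\mathcal D}^+$-module $W$ with generating highest weight vector $w$, let $\delta$ be the linear functional on the span of the $L_0^{(k)}$, $k\in\mathbb{N}$, in $\hat{\mathcal D}^+$ defined by $L_0^{(k)}\cdot w=(-1)^k\delta(L_0^{(k)})w$, and let $$\Delta(x)=\sum_{k\ge0}\frac{\delta(L_0^{(k)})x^{2k}}{(2k)!}.$$ Then for every isometry $\nu$ of $\mathfrak h$ of period $p>0$ preserving a rational lattice in $\mathfrak h$, the submodule $\mathcal U(\hat{\mathcal D}^+)\cdot1\subset S[\nu]$ is a quasi-finite highest weight $\hat{\mathcal D}^+$-module (with highest weight vector $1$) satisfying $$\Delta(x)=\frac12\frac{d}{dx}\sum_{k=0}^{p-1}\frac{(e^{kx/p}-1)\dim\mathfrak h_{(k)}}{1-e^x}.$$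
   Context: $\mathbb{N}$ denotes the nonnegative integers. The Lie algebra $\hat{\mathcal D}^+$: $\mathcal D$ is the Lie algebra of formal differential operators on $\mathbb{C}^\times$ spanned by $t^nD^r$, $D=t\frac{d}{dt}$, $n\in\mathbb{Z}$, $r\in\mathbb{N}$. Let $\Psi$ be the 2-cocycle determined by $\Psi(t^mf(D),t^ng(D))=-\Psi(t^ng(D),t^mf(D))=\delta_{m+n,0}\sum_{i=1}^mf(-i)g(m-i)$ for $m>0$. $\mathcal D^+$ is the Lie subalgebra of $\mathcal D$ generated by $L_n^{(r)}=(-1)^{r+1}D^r(t^nD)D^r$ ($n\in\mathbb{Z},r\in\mathbb{N}$), and $\hat{\mathcal D}^+=\mathbb{C}c\oplus\mathcal D^+$ is its central extension by the 2-cocycle $-\frac12\Psi$. It is $\mathbb{Z}$-graded by the power of $t$ ($c$ in degree $0$). A highest weight module is one generated by a vector $w$ annihilated by all $L_n^{(r)}$ with $n>0$ that is a common eigenvector of all $L_0^{(r)}$ and $c$; it is quasi-finite if the homogeneous subspaces of its induced $\mathbb{Z}$-grading (with $w$ homogeneous) are finite-dimensional. Twisted space: isometry of period $p$ means $\langle\nu\alpha,\nu\beta\rangle=\langle\alpha,\beta\rangle$, $\nu^p=1$. Fix a primitive $p$-th root of unity $\omega_p$; $\mathfrak h_{(r)}=\{\alpha\in\mathfrak h:\nu\alpha=\omega_p^r\alpha\}$ ($r\in\mathbb{Z}$), $\alpha_{(r)}$ is the projection of $\alpha$ on $\mathfrak h_{(r)}$. $\hat{\mathfrak h}[\nu]=\coprod_{n\in\frac1p\mathbb{Z}}\mathfrak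 h_{(pn)}\otimes t^n\oplus\mathbb{C}C$, with $C$ central and $[\alpha\otimes t^m,\beta\otimes t^n]=\langle\alpha,\beta\rangle m\delta_{m+n,0}C$ for $\alpha\in\mathfrak h_{(pm)},\beta\in\mathfrak h_{(pn)}$. $\hat{\mathfrak h}[\nu]^{\pm}=\coprod_{\pm n>0}\mathfrak h_{(pn)}\otimes t^n$. $S[\nu]=\mathcal U(\hat{\mathfrak h}[\nu])\otimes_{\mathcal U(\hat{\mathfrak h}[\nu]^+\oplus\mathfrak h_{(0)}\oplus\mathbb{C}C)}\mathbb{C}\simeq S(\hat{\mathfrak h}[\nu]^-)$, where $\hat{\mathfrak h}[\nu]^+\oplus\mathfrak h_{(0)}$ acts trivially on $\mathbb{C}$ and $C$ acts as $1$; $1\in S[\nu]$ is the generating vector. For $\alpha\in\mathfrak h$, $n\in\frac1p\mathbb{Z}$, $\alpha(n)$ denotes the action of $\alpha_{(pn)}\otimes t^n$, and $\alpha^\nu\langle x\rangle=\sum_{n\in\frac1p\mathbb{Z}}\alpha(n)x^{-n}$. $S[\nu]$ is a $\hat{\mathcal D}^+$-module via the representation $L_n^{(r)}\mapsto L^{(r)}(n)$, $c\mapsto d$, where $L^{(r)}(n)=L^{(r,r)}(n)$ and, with $\{\alpha_q\}_{q=1}^d$ an orthonormal basis of $\mathfrak h$ and $:\cdot:$ the normal ordering placing $\alpha(n)$ with $n>0$ to the right, $$\sum_{n\in\mathbb{Z},\,r_1,r_2\in\mathbb{N}}L^{(r_1,r_2)}(n)x^{-n}\frac{y_1^{r_1}y_2^{r_2}}{r_1!r_2!}=\frac12\sum_{q=1}^d:\alpha_q^\nu\langle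 e^{y_1}x\rangle\alpha_q^\nu\langle e^{y_2}x\rangle:-\frac12\frac{\partial}{\partial y_1}\Big(\sum_{k=0}^{p-1}\frac{\big(e^{k(-y_1+y_2)/p}-1\big)\dim\mathfrak h_{(k)}}{1-e^{-y_1+y_2}}\Big).$$ *)

theory Defs
  imports
    "HOL-Analysis.Analysis"
    "HOL-Library.Poly_Mapping"
    "HOL-Computational_Algebra.Computational_Algebra"
begin

section \<open>Modules for complex Lie algebras\<close>

text \<open>
  A Lie algebra is given by a scaling \<open>sg\<close>, a bracket \<open>br\<close> and a carrier \<open>G\<close>, which may be a
  proper subspace of its type.  Likewise a module is a subspace \<open>W\<close> of an ambient complex vector
  space \<open>(UNIV, sv)\<close>; only the values \<open>\<rho> x v\<close> with \<open>x \<in> G\<close> and \<open>v \<in> W\<close> are relevant.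
\<close>

definition lie_module ::
  "(complex \<Rightarrow> 'g::ab_group_add \<Rightarrow> 'g) \<Rightarrow> ('g \<Rightarrow> 'g \<Rightarrow> 'g) \<Rightarrow> 'g set \<Rightarrow>
   (complex \<Rightarrow> 'v::ab_group_add \<Rightarrow> 'v) \<Rightarrow> 'v set \<Rightarrow> ('g \<Rightarrow> 'v \<Rightarrow> 'v) \<Rightarrow> bool" where
  "lie_module sg br G sv W \<rho> \<longleftrightarrow>
     vector_space sv \<and> module.subspace sv W \<and>
     (\<forall>x\<in>G. \<forall>v\<in>W. \<rho> x v \<in> W) \<and>
     (\<forall>x\<in>G. \<forall>v\<in>W. \<forall>v'\<in>W. \<rho> x (v + v') = \<rho> x v + \<rho> x v') \<and>
     (\<forall>x\<in>G. \<forall>c. \<forall>v\<in>W. \<rho> x (sv c v) = sv c (\<rho> x v)) \<and>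
     (\<forall>x\<in>G. \<forall>y\<in>G. \<forall>v\<in>W. \<rho> (x + y) v = \<rho> x v + \<rho> y v) \<and>
     (\<forall>x\<in>G. \<forall>c. \<forall>v\<in>W. \<rho> (sg c x) v = sv c (\<rho> x v)) \<and>
     (\<forall>x\<in>G. \<forall>y\<in>G. \<forall>v\<in>W. \<rho> (br x y) v = \<rho> x (\<rho> y v) - \<rho> y (\<rho> x v))"

text \<open>\<open>\<U>(G) \<cdot> w\<close>: the universal enveloping algebra is spanned by the monomials in elements of \<open>G\<close>.\<close>

definition enveloping_orbit ::
  "'g set \<Rightarrow> (complex \<Rightarrow> 'v::ab_group_add \<Rightarrow> 'v) \<Rightarrow> ('g \<Rightarrow> 'v \<Rightarrow> 'v) \<Rightarrow> 'v \<Rightarrow> 'v set" where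
  "enveloping_orbit G sv \<rho> w = module.span sv {foldr \<rho> xs w | xs. set xs \<subseteq> G}"


subsection \<open>Induced modules\<close>

text \<open>
  The tensor algebra of \<open>G\<close> is a quotient of the free vector space on words over \<open>G\<close>.  For a
  subalgebra \<open>B\<close> of \<open>G\<close> and a character \<open>ch\<close> of \<open>B\<close>, the module \<open>\<U>(G) \<otimes> \<complex>\<close> over \<open>\<U>(B)\<close>, with \<open>B\<close>
  acting on \<open>\<complex>\<close> through \<open>ch\<close>, is the quotient of that space by the relations below: the first two
  groups give the tensor algebra, the third gives \<open>\<U>(G)\<close>, and the last one says
  \<open>u x \<otimes> 1 = u \<otimes> ch(x)\<close>.
\<close>

definition word_scale :: "complex \<Rightarrow> ('g list \<Rightarrow>\<^sub>0 complex) \<Rightarrow> ('g list \<Rightarrow>\<^sub>0 complex)" where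
  "word_scale c f = Poly_Mapping.map ((*) c) f"

definition word_space :: "'g set \<Rightarrow> ('g list \<Rightarrow>\<^sub>0 complex) set" where
  "word_space G = {f. \<forall>u\<in>Poly_Mapping.keys f. set u \<subseteq> G}"

definition induced_relations ::
  "(complex \<Rightarrow> 'g::ab_group_add \<Rightarrow> 'g) \<Rightarrow> ('g \<Rightarrow> 'g \<Rightarrow> 'g) \<Rightarrow> 'g set \<Rightarrow> 'g set \<Rightarrow> ('g \<Rightarrow> complex) \<Rightarrow>
   ('g list \<Rightarrow>\<^sub>0 complex) set" where
  "induced_relations sg br G B ch =
     (let m = (\<lambda>u c. Poly_Mapping.single u c :: 'g list \<Rightarrow>\<^sub>0 complex) in
      {m (u @ [x + y] @ v) 1 - m (u @ [x] @ v) 1 - m (u @ [y] @ v) 1 | u v x y.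
         set u \<subseteq> G \<and> set v \<subseteq> G \<and> x \<in> G \<and> y \<in> G} \<union>
      {m (u @ [sg c x] @ v) 1 - m (u @ [x] @ v) c | u v c x.
         set u \<subseteq> G \<and> set v \<subseteq> G \<and> x \<in> G} \<union>
      {m (u @ [x, y] @ v) 1 - m (u @ [y, x] @ v) 1 - m (u @ [br x y] @ v) 1 | u v x y.
         set u \<subseteq> G \<and> set v \<subseteq> G \<and> x \<in> G \<and> y \<in> G} \<union>
      {m (u @ [x]) 1 - m u (ch x) | u x. set u \<subseteq> G \<and> x \<in> B})"

definition word_apply ::
  "(complex \<Rightarrow> 'v::ab_group_add \<Rightarrow> 'v) \<Rightarrow> ('g \<Rightarrow> 'v \<Rightarrow> 'v) \<Rightarrow> 'v \<Rightarrow> ('g list \<Rightarrow>\<^sub>0 complex) \<Rightarrow> 'v" where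
  "word_apply sv \<pi> e f =
     (\<Sum>u\<in>Poly_Mapping.keys f. sv (Poly_Mapping.lookup f u) (foldr \<pi> u e))"

text \<open>
  \<open>(UNIV, \<pi>)\<close> is the induced module with generating vector \<open>e = 1 \<otimes> 1\<close>: sending a word
  \<open>x\<^sub>1 \<dots> x\<^sub>m\<close> to \<open>\<pi>(x\<^sub>1) \<dots> \<pi>(x\<^sub>m) e\<close> identifies it with the quotient described above.
\<close>

definition induced_module ::
  "(complex \<Rightarrow> 'g::ab_group_add \<Rightarrow> 'g) \<Rightarrow> ('g \<Rightarrow> 'g \<Rightarrow> 'g) \<Rightarrow> 'g set \<Rightarrow> 'g set \<Rightarrow> ('g \<Rightarrow> complex) \<Rightarrow>
   (complex \<Rightarrow> 'v::ab_group_add \<Rightarrow> 'v) \<Rightarrow> ('g \<Rightarrow> 'v \<Rightarrow> 'v) \<Rightarrow> 'v \<Rightarrow> bool" where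
  "induced_module sg br G B ch sv \<pi> e \<longleftrightarrow>
     lie_module sg br G sv UNIV \<pi> \<and>
     word_apply sv \<pi> e ` word_space G = UNIV \<and>
     {f \<in> word_space G. word_apply sv \<pi> e f = 0} =
       module.span word_scale (induced_relations sg br G B ch)"


section \<open>The Lie algebra of formal differential operators and its subalgebra\<close>

text \<open>
  The operator \<open>\<Sum>\<^sub>n t\<^sup>n f\<^sub>n(D)\<close> is the finitely supported family \<open>n \<mapsto> f\<^sub>n\<close> of polynomials.  The
  convolution product that the type \<open>int \<Rightarrow>\<^sub>0 complex poly\<close> carries is not the product of operators;
  the latter comes from \<open>f(D) t\<^sup>n = t\<^sup>n f(D + n)\<close>.
\<close>

type_synonym diffop = "int \<Rightarrow>\<^sub>0 complex poly"

definition diffop_scale :: "complex \<Rightarrow> diffop \<Rightarrow> diffop" where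
  "diffop_scale c a = Poly_Mapping.map (smult c) a"

definition diffop_mult :: "diffop \<Rightarrow> diffop \<Rightarrow> diffop" where
  "diffop_mult a b =
     (\<Sum>m\<in>Poly_Mapping.keys a. \<Sum>n\<in>Poly_Mapping.keys b.
        Poly_Mapping.single (m + n)
          (pcompose (Poly_Mapping.lookup a m) [:of_int n, 1:] * Poly_Mapping.lookup b n))"

definition diffop_bracket :: "diffop \<Rightarrow> diffop \<Rightarrow> diffop" where
  "diffop_bracket a b = diffop_mult a b - diffop_mult b a"

definition D_power :: "nat \<Rightarrow> diffop" where
  "D_power r = Poly_Mapping.single 0 (monom 1 r)"

definition tD :: "int \<Rightarrow> diffop" where
  "tD n = Poly_Mapping.single n (monom 1 1)"

definition L_gen :: "int \<Rightarrow> nat \<Rightarrow> diffop" where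
  "L_gen n r =
     diffop_scale ((- 1) ^ (r + 1)) (diffop_mult (diffop_mult (D_power r) (tD n)) (D_power r))"

inductive_set D_plus :: "diffop set" where
  gen: "L_gen n r \<in> D_plus"
| zero: "0 \<in> D_plus"
| add: "a \<in> D_plus \<Longrightarrow> b \<in> D_plus \<Longrightarrow> a + b \<in> D_plus"
| scale: "a \<in> D_plus \<Longrightarrow> diffop_scale c a \<in> D_plus"
| bracket: "a \<in> D_plus \<Longrightarrow> b \<in> D_plus \<Longrightarrow> diffop_bracket a b \<in> D_plus"

text \<open>
  \<open>\<Psi>(t\<^sup>m f(D), t\<^sup>n g(D))\<close>: for \<open>m > 0\<close> the second sum is empty when \<open>m + n = 0\<close>, for \<open>m < 0\<close>
  the first one is (antisymmetry), and for \<open>m = 0\<close> both are.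
\<close>

definition Psi_term :: "int \<Rightarrow> complex poly \<Rightarrow> int \<Rightarrow> complex poly \<Rightarrow> complex" where
  "Psi_term m f n g =
     (if m + n = 0 then
        (\<Sum>i\<in>{1..m}. poly f (of_int (- i)) * poly g (of_int (m - i))) -
        (\<Sum>i\<in>{1..n}. poly g (of_int (- i)) * poly f (of_int (n - i)))
      else 0)"

definition Psi :: "diffop \<Rightarrow> diffop \<Rightarrow> complex" where
  "Psi a b =
     (\<Sum>m\<in>Poly_Mapping.keys a. \<Sum>n\<in>Poly_Mapping.keys b.
        Psi_term m (Poly_Mapping.lookup a m) n (Poly_Mapping.lookup b n))"

text \<open>The pair \<open>(z, a)\<close> stands for \<open>z c + a\<close> in the central extension.\<close>

type_synonym dhat = "complex \<times> diffop"

definition dhat_scale :: "complex \<Rightarrow> dhat \<Rightarrow> dhat" where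
  "dhat_scale c x = (c * fst x, diffop_scale c (snd x))"

definition dhat_bracket :: "dhat \<Rightarrow> dhat \<Rightarrow> dhat" where
  "dhat_bracket x y = (- (1 / 2) * Psi (snd x) (snd y), diffop_bracket (snd x) (snd y))"

definition dhat_plus :: "dhat set" where
  "dhat_plus = UNIV \<times> D_plus"

definition dhat_c :: dhat where
  "dhat_c = (1, 0)"

definition dhat_L :: "int \<Rightarrow> nat \<Rightarrow> dhat" where
  "dhat_L n r = (0, L_gen n r)"

definition dhat_plus_degree :: "int \<Rightarrow> dhat set" where
  "dhat_plus_degree n =
     {x \<in> dhat_plus. Poly_Mapping.keys (snd x) \<subseteq> {n} \<and> (n \<noteq> 0 \<longrightarrow> fst x = 0)}"


subsection \<open>Highest weight modules\<close>

definition highest_weight_module ::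
  "(complex \<Rightarrow> 'v::ab_group_add \<Rightarrow> 'v) \<Rightarrow> 'v set \<Rightarrow> (dhat \<Rightarrow> 'v \<Rightarrow> 'v) \<Rightarrow> 'v \<Rightarrow> bool" where
  "highest_weight_module sv W \<rho> w \<longleftrightarrow>
     lie_module dhat_scale dhat_bracket dhat_plus sv W \<rho> \<and>
     w \<in> W \<and> w \<noteq> 0 \<and>
     W = enveloping_orbit dhat_plus sv \<rho> w \<and>
     (\<forall>n r. n > 0 \<longrightarrow> \<rho> (dhat_L n r) w = 0) \<and>
     (\<forall>r. \<exists>z. \<rho> (dhat_L 0 r) w = sv z w) \<and>
     (\<exists>z. \<rho> dhat_c w = sv z w)"

text \<open>
  Homogeneous subspaces of \<open>\<U> \<cdot> w\<close>, with \<open>w\<close> in degree \<open>0\<close>: the span of the vectors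
  \<open>x\<^sub>1 \<dots> x\<^sub>m w\<close> with \<open>x\<^sub>i\<close> homogeneous and total degree \<open>k\<close>.
\<close>

definition homogeneous_subspace ::
  "(complex \<Rightarrow> 'v::ab_group_add \<Rightarrow> 'v) \<Rightarrow> (dhat \<Rightarrow> 'v \<Rightarrow> 'v) \<Rightarrow> 'v \<Rightarrow> int \<Rightarrow> 'v set" where
  "homogeneous_subspace sv \<rho> w k =
     module.span sv {foldr \<rho> (map fst xs) w | xs :: (dhat \<times> int) list.
       (\<forall>(x, n)\<in>set xs. x \<in> dhat_plus_degree n) \<and> sum_list (map snd xs) = k}"

definition quasi_finite_highest_weight_module ::
  "(complex \<Rightarrow> 'v::ab_group_add \<Rightarrow> 'v) \<Rightarrow> 'v set \<Rightarrow> (dhat \<Rightarrow> 'v \<Rightarrow> 'v) \<Rightarrow> 'v \<Rightarrow> bool" where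
  "quasi_finite_highest_weight_module sv W \<rho> w \<longleftrightarrow>
     highest_weight_module sv W \<rho> w \<and>
     (\<forall>k. \<exists>E. finite E \<and> homogeneous_subspace sv \<rho> w k \<subseteq> module.span sv E)"

text \<open>\<open>\<delta>\<close> matters only on the span of the \<open>L\<^sub>0\<^sup>(\<^sup>k\<^sup>)\<close>.\<close>

definition weight_functional ::
  "(complex \<Rightarrow> 'v::ab_group_add \<Rightarrow> 'v) \<Rightarrow> (dhat \<Rightarrow> 'v \<Rightarrow> 'v) \<Rightarrow> 'v \<Rightarrow> (dhat \<Rightarrow> complex) \<Rightarrow> bool" where
  "weight_functional sv \<rho> w \<delta> \<longleftrightarrow>
     (let U = module.span dhat_scale (range (dhat_L 0)) in
      (\<forall>x\<in>U. \<forall>y\<in>U. \<delta> (x + y) = \<delta> x + \<delta> y) \<and>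
      (\<forall>x\<in>U. \<forall>c. \<delta> (dhat_scale c x) = c * \<delta> x)) \<and>
     (\<forall>k. \<rho> (dhat_L 0 k) w = sv ((- 1) ^ k * \<delta> (dhat_L 0 k)) w)"

definition Delta :: "(dhat \<Rightarrow> complex) \<Rightarrow> complex fps" where
  "Delta \<delta> = Abs_fps (\<lambda>n. if even n then \<delta> (dhat_L 0 (n div 2)) / fact n else 0)"


section \<open>The twisted space\<close>

definition nondegenerate_symmetric_form ::
  "(complex \<Rightarrow> 'h::ab_group_add \<Rightarrow> 'h) \<Rightarrow> ('h \<Rightarrow> 'h \<Rightarrow> complex) \<Rightarrow> bool" where
  "nondegenerate_symmetric_form hs form \<longleftrightarrow>
     (\<forall>x. Vector_Spaces.linear hs (*) (form x)) \<and>
     (\<forall>x y. form x y = form y x) \<and>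
     (\<forall>x. (\<forall>y. form x y = 0) \<longrightarrow> x = 0)"

definition isometry_of_period ::
  "(complex \<Rightarrow> 'h::ab_group_add \<Rightarrow> 'h) \<Rightarrow> ('h \<Rightarrow> 'h \<Rightarrow> complex) \<Rightarrow> ('h \<Rightarrow> 'h) \<Rightarrow> nat \<Rightarrow> bool" where
  "isometry_of_period hs form \<nu> p \<longleftrightarrow>
     Vector_Spaces.linear hs hs \<nu> \<and>
     (\<forall>x y. form (\<nu> x) (\<nu> y) = form x y) \<and>
     \<nu> ^^ p = id"

text \<open>A rational lattice in \<open>\<hh>\<close> has full rank, and the form takes rational values on it.\<close>

definition rational_lattice ::
  "(complex \<Rightarrow> 'h::ab_group_add \<Rightarrow> 'h) \<Rightarrow> ('h \<Rightarrow> 'h \<Rightarrow> complex) \<Rightarrow> 'h set \<Rightarrow> bool" where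
  "rational_lattice hs form \<Lambda> \<longleftrightarrow>
     (\<exists>E. finite_dimensional_vector_space hs E \<and>
          \<Lambda> = {(\<Sum>e\<in>E. hs (of_int (z e)) e) | z :: 'h \<Rightarrow> int. True}) \<and>
     (\<forall>x\<in>\<Lambda>. \<forall>y\<in>\<Lambda>. form x y \<in> \<rat>)"

definition primitive_root_of_unity :: "nat \<Rightarrow> complex \<Rightarrow> bool" where
  "primitive_root_of_unity p \<omega> \<longleftrightarrow> \<omega> ^ p = 1 \<and> (\<forall>k. 0 < k \<and> k < p \<longrightarrow> \<omega> ^ k \<noteq> 1)"

definition orthonormal_basis ::
  "(complex \<Rightarrow> 'h::ab_group_add \<Rightarrow> 'h) \<Rightarrow> ('h \<Rightarrow> 'h \<Rightarrow> complex) \<Rightarrow> 'h set \<Rightarrow> bool" where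
  "orthonormal_basis hs form Q \<longleftrightarrow>
     finite_dimensional_vector_space hs Q \<and>
     (\<forall>a\<in>Q. \<forall>b\<in>Q. form a b = (if a = b then 1 else 0))"

definition eigen_part ::
  "(complex \<Rightarrow> 'h \<Rightarrow> 'h) \<Rightarrow> ('h \<Rightarrow> 'h) \<Rightarrow> complex \<Rightarrow> int \<Rightarrow> 'h set" where
  "eigen_part hs \<nu> \<omega> r = {\<alpha>. \<nu> \<alpha> = hs (\<omega> powi r) \<alpha>}"

text \<open>
  The projection of \<open>\<alpha>\<close> on \<open>\<hh>\<^sub>(\<^sub>r\<^sub>)\<close> along the decomposition of \<open>\<hh>\<close> into the \<open>\<hh>\<^sub>(\<^sub>k\<^sub>)\<close>, \<open>0 \<le> k < p\<close>:
  the component with index \<open>r mod p\<close> in the unique way to write \<open>\<alpha>\<close> as a sum of such components.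
\<close>

definition eigen_proj ::
  "(complex \<Rightarrow> 'h::ab_group_add \<Rightarrow> 'h) \<Rightarrow> ('h \<Rightarrow> 'h) \<Rightarrow> complex \<Rightarrow> nat \<Rightarrow> int \<Rightarrow> 'h \<Rightarrow> 'h" where
  "eigen_proj hs \<nu> \<omega> p r \<alpha> =
     (THE \<beta>. \<exists>f. (\<forall>k\<in>{0..<int p}. f k \<in> eigen_part hs \<nu> \<omega> k) \<and>
                 (\<Sum>k\<in>{0..<int p}. f k) = \<alpha> \<and> f (r mod int p) = \<beta>)"

text \<open>
  Modes \<open>n \<in> (1/p)\<int>\<close> are encoded by the integer \<open>k = p n\<close>: the pair \<open>(z, x)\<close> stands for
  \<open>z C + \<Sum>\<^sub>k x\<^sub>k \<otimes> t\<^bsup>k/p\<^esup>\<close>, where \<open>x\<^sub>k \<in> \<hh>\<^sub>(\<^sub>k\<^sub>)\<close>.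
\<close>

type_synonym 'h heis = "complex \<times> (int \<Rightarrow>\<^sub>0 'h)"

definition heis_scale ::
  "(complex \<Rightarrow> 'h::ab_group_add \<Rightarrow> 'h) \<Rightarrow> complex \<Rightarrow> 'h heis \<Rightarrow> 'h heis" where
  "heis_scale hs c x = (c * fst x, Poly_Mapping.map (hs c) (snd x))"

definition heis_bracket ::
  "('h \<Rightarrow> 'h \<Rightarrow> complex) \<Rightarrow> nat \<Rightarrow> 'h::ab_group_add heis \<Rightarrow> 'h heis \<Rightarrow> 'h heis" where
  "heis_bracket form p x y =
     (\<Sum>k\<in>Poly_Mapping.keys (snd x).
        form (Poly_Mapping.lookup (snd x) k) (Poly_Mapping.lookup (snd y) (- k)) *
          (of_int k / of_nat p), 0)"

definition heis ::
  "(complex \<Rightarrow> 'h::ab_group_add \<Rightarrow> 'h) \<Rightarrow> ('h \<Rightarrow> 'h) \<Rightarrow> complex \<Rightarrow> 'h heis set" where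
  "heis hs \<nu> \<omega> = {x. \<forall>k. Poly_Mapping.lookup (snd x) k \<in> eigen_part hs \<nu> \<omega> k}"

definition heis_nonneg ::
  "(complex \<Rightarrow> 'h::ab_group_add \<Rightarrow> 'h) \<Rightarrow> ('h \<Rightarrow> 'h) \<Rightarrow> complex \<Rightarrow> 'h heis set" where
  "heis_nonneg hs \<nu> \<omega> = {x \<in> heis hs \<nu> \<omega>. \<forall>k<0. Poly_Mapping.lookup (snd x) k = 0}"

text \<open>
  \<open>S[\<nu>]\<close>, with \<open>\<pi>\<close> the action of the twisted Heisenberg algebra and \<open>e\<close> the generating vector \<open>1\<close>.
  The character \<open>fst\<close> sends \<open>C\<close> to \<open>1\<close> and kills the modes \<open>n \<ge> 0\<close>.
\<close>

definition twisted_space ::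
  "(complex \<Rightarrow> 'h::ab_group_add \<Rightarrow> 'h) \<Rightarrow> ('h \<Rightarrow> 'h \<Rightarrow> complex) \<Rightarrow> ('h \<Rightarrow> 'h) \<Rightarrow> nat \<Rightarrow> complex \<Rightarrow>
   (complex \<Rightarrow> 'v::ab_group_add \<Rightarrow> 'v) \<Rightarrow> ('h heis \<Rightarrow> 'v \<Rightarrow> 'v) \<Rightarrow> 'v \<Rightarrow> bool" where
  "twisted_space hs form \<nu> p \<omega> sv \<pi> e \<longleftrightarrow>
     induced_module (heis_scale hs) (heis_bracket form p) (heis hs \<nu> \<omega>) (heis_nonneg hs \<nu> \<omega>) fst
       sv \<pi> e"

text \<open>The operator \<open>\<alpha>(k/p)\<close>.\<close>

definition mode_op ::
  "(complex \<Rightarrow> 'h::ab_group_add \<Rightarrow> 'h) \<Rightarrow> ('h \<Rightarrow> 'h) \<Rightarrow> nat \<Rightarrow> complex \<Rightarrow> ('h heis \<Rightarrow> 'v \<Rightarrow> 'v) \<Rightarrow>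
   'h \<Rightarrow> int \<Rightarrow> 'v \<Rightarrow> 'v" where
  "mode_op hs \<nu> p \<omega> \<pi> \<alpha> k = \<pi> (0, Poly_Mapping.single k (eigen_proj hs \<nu> \<omega> p k \<alpha>))"

definition normal_ordered ::
  "(complex \<Rightarrow> 'h::ab_group_add \<Rightarrow> 'h) \<Rightarrow> ('h \<Rightarrow> 'h) \<Rightarrow> nat \<Rightarrow> complex \<Rightarrow> ('h heis \<Rightarrow> 'v \<Rightarrow> 'v) \<Rightarrow>
   'h \<Rightarrow> int \<Rightarrow> 'h \<Rightarrow> int \<Rightarrow> 'v \<Rightarrow> 'v" where
  "normal_ordered hs \<nu> p \<omega> \<pi> \<alpha> k \<beta> l v =
     (if k > 0 then mode_op hs \<nu> p \<omega> \<pi> \<beta> l (mode_op hs \<nu> p \<omega> \<pi> \<alpha> k v)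
      else mode_op hs \<nu> p \<omega> \<pi> \<alpha> k (mode_op hs \<nu> p \<omega> \<pi> \<beta> l v))"

text \<open>
  The substitution \<open>G(y\<^sub>2 - y\<^sub>1)\<close>.  In \<open>complex fps fps\<close> the outer variable is \<open>y\<^sub>1\<close> and the inner
  one, entering through \<open>fps_const\<close>, is \<open>y\<^sub>2\<close>; thus \<open>F $ a $ b\<close> is the coefficient of
  \<open>y\<^sub>1\<^sup>a y\<^sub>2\<^sup>b\<close> and \<open>fps_deriv\<close> is the derivative in \<open>y\<^sub>1\<close>.  Powers \<open>(y\<^sub>2 - y\<^sub>1)\<^sup>n\<close> with
  \<open>n > a + b\<close> do not contribute to that coefficient.  (\<open>fps_compose\<close> does not apply, since
  \<open>y\<^sub>2 - y\<^sub>1\<close> has a constant term in \<open>y\<^sub>1\<close>.)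
\<close>

definition subst_diff :: "complex fps \<Rightarrow> complex fps fps" where
  "subst_diff G =
     Abs_fps (\<lambda>a. Abs_fps (\<lambda>b. \<Sum>n\<le>a + b. G $ n * ((fps_const fps_X - fps_X) ^ n) $ a $ b))"

text \<open>
  \<open>L\<^sup>(\<^sup>r\<^sup>1\<^sup>,\<^sup>r\<^sup>2\<^sup>)(n)\<close>, the coefficient of \<open>x\<^sup>-\<^sup>n y\<^sub>1\<^sup>r\<^sup>1 y\<^sub>2\<^sup>r\<^sup>2 / (r1! r2!)\<close> in the generating function.  In the
  quadratic part the coefficient of \<open>x\<^sup>-\<^sup>n\<close> in \<open>:\<alpha>\<langle>e\<^sup>y\<^sup>1 x\<rangle> \<alpha>\<langle>e\<^sup>y\<^sup>2 x\<rangle>:\<close> is the sum of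
  \<open>:\<alpha>(i) \<alpha>(j):\<close> times \<open>exp (- i y\<^sub>1) exp (- j y\<^sub>2)\<close> over \<open>i + j = n\<close>, where \<open>i = k/p\<close>; applied to a vector
  of \<open>S[\<nu>]\<close>, only finitely many summands are nonzero.  The remaining part does not involve \<open>x\<close>.
\<close>

definition twisted_L ::
  "(complex \<Rightarrow> 'h::ab_group_add \<Rightarrow> 'h) \<Rightarrow> ('h \<Rightarrow> 'h) \<Rightarrow> nat \<Rightarrow> complex \<Rightarrow> 'h set \<Rightarrow>
   (complex \<Rightarrow> 'v::ab_group_add \<Rightarrow> 'v) \<Rightarrow> ('h heis \<Rightarrow> 'v \<Rightarrow> 'v) \<Rightarrow> int \<Rightarrow> nat \<Rightarrow> nat \<Rightarrow> 'v \<Rightarrow> 'v" where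
  "twisted_L hs \<nu> p \<omega> Q sv \<pi> n r1 r2 v =
     sv (fact r1 * fact r2)
       (sv (1 / 2)
          (\<Sum>\<alpha>\<in>Q. Sum_any (\<lambda>k::int.
             sv (fps_exp (- (of_int k / of_nat p)) $ r1 *
                 fps_exp (- (of_int n - of_int k / of_nat p)) $ r2)
               (normal_ordered hs \<nu> p \<omega> \<pi> \<alpha> k \<alpha> (int p * n - k) v)))
        - sv (if n = 0 then
                1 / 2 * fps_deriv (subst_diff
                  (\<Sum>k<p. (fps_exp (of_nat k / of_nat p) - 1) *
                           of_nat (vector_space.dim hs (eigen_part hs \<nu> \<omega> (int k)))
                           / (1 - fps_exp 1))) $ r1 $ r2
              else 0) v)"

text \<open>
  \<open>\<rho>\<close> is the module structure on \<open>S[\<nu>]\<close> with \<open>L\<^sub>n\<^sup>(\<^sup>r\<^sup>) \<mapsto> L\<^sup>(\<^sup>r\<^sup>,\<^sup>r\<^sup>)(n)\<close> and \<open>c \<mapsto> d\<close>; since the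
  \<open>L\<^sub>n\<^sup>(\<^sup>r\<^sup>)\<close> generate \<open>D_plus\<close>, these values determine it on \<open>dhat_plus\<close>.
\<close>

definition twisted_action ::
  "(complex \<Rightarrow> 'h::ab_group_add \<Rightarrow> 'h) \<Rightarrow> ('h \<Rightarrow> 'h) \<Rightarrow> nat \<Rightarrow> complex \<Rightarrow> 'h set \<Rightarrow>
   (complex \<Rightarrow> 'v::ab_group_add \<Rightarrow> 'v) \<Rightarrow> ('h heis \<Rightarrow> 'v \<Rightarrow> 'v) \<Rightarrow> (dhat \<Rightarrow> 'v \<Rightarrow> 'v) \<Rightarrow> bool" where
  "twisted_action hs \<nu> p \<omega> Q sv \<pi> \<rho> \<longleftrightarrow>
     lie_module dhat_scale dhat_bracket dhat_plus sv UNIV \<rho> \<and>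
     (\<forall>n r v. \<rho> (dhat_L n r) v = twisted_L hs \<nu> p \<omega> Q sv \<pi> n r r v) \<and>
     (\<forall>v. \<rho> dhat_c v = sv (of_nat (vector_space.dim hs UNIV)) v)"

end

theory Submission
  imports Defs
begin

text \<open>
  Three points need an argument; \<open>G\<close> denotes the series whose derivative appears in the theorem.

  The vector \<open>1 \<in> S[\<nu>]\<close> is nonzero: the vacuum expectation value of a word in the Heisenberg
  algebra, computed by letting the word act from the right on linear functionals on the symmetric
  algebra, respects all relations of the induced module and is 1 on the empty word.

  The module is quasi-finite: \<open>L\<^sup>(\<^sup>r\<^sup>)(n)\<close> lowers the natural \<open>(1/p)\<int>\<close>-grading of \<open>S[\<nu>]\<close>, whose
  pieces are finite-dimensional, by \<open>n\<close>.  Homogeneous components of a bracket are sums of brackets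
  of homogeneous components, so every element of degree \<open>n\<close> does the same.

  The quadratic part of \<open>L\<^sup>(\<^sup>r\<^sup>)(0)\<close> kills \<open>1\<close>, so the weights are, up to factorials, the diagonal
  coefficients of \<open>-\<partial>/\<partial>y\<^sub>1 G(y\<^sub>2 - y\<^sub>1)/2\<close>, that is, the coefficients of \<open>G\<close> of odd index.  Those of
  positive even index vanish: the form pairs \<open>\<hh>\<^sub>(\<^sub>k\<^sub>)\<close> with \<open>\<hh>\<^sub>(\<^sub>p\<^sub>-\<^sub>k\<^sub>)\<close>, hence \<open>G(x) + G(-x)\<close> is constant.
\<close>

section \<open>Vacuum expectation values\<close>

lemma lookup_word_scale: "Poly_Mapping.lookup (word_scale c f) u = c * Poly_Mapping.lookup f u"
  by (simp add: word_scale_def map.rep_eq when_def)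

lemma vector_space_word_scale: "vector_space (word_scale :: complex \<Rightarrow> ('g list \<Rightarrow>\<^sub>0 complex) \<Rightarrow> _)"
  by unfold_locales
    (simp_all add: poly_mapping_eq_iff fun_eq_iff lookup_word_scale lookup_add algebra_simps)

lemma sum_keys_superset:
  assumes "vector_space sv" "finite A" "Poly_Mapping.keys f \<subseteq> A"
  shows "(\<Sum>u\<in>Poly_Mapping.keys f. sv (Poly_Mapping.lookup f u) (\<phi> u))
       = (\<Sum>u\<in>A. sv (Poly_Mapping.lookup f u) (\<phi> u))"
proof -
  interpret vector_space sv by fact
  show ?thesis
    by (rule sum.mono_neutral_left) (use assms in \<open>auto simp: in_keys_iff\<close>)
qed

text \<open>With the next three lemmas this is linearity of the extension of \<open>\<phi>\<close>
  to the free vector space. The target is an arbitrary vector space, so that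
  \<open>word_apply\<close> and scalar functionals are both covered.\<close>

lemma sum_keys_add:
  assumes "vector_space sv"
  shows "(\<Sum>u\<in>Poly_Mapping.keys (f + g). sv (Poly_Mapping.lookup (f + g) u) (\<phi> u))
       = (\<Sum>u\<in>Poly_Mapping.keys f. sv (Poly_Mapping.lookup f u) (\<phi> u))
       + (\<Sum>u\<in>Poly_Mapping.keys g. sv (Poly_Mapping.lookup g u) (\<phi> u))"
proof -
  interpret vector_space sv by fact
  let ?A = "Poly_Mapping.keys f \<union> Poly_Mapping.keys g"
  have A: "finite ?A" "Poly_Mapping.keys (f + g) \<subseteq> ?A" "Poly_Mapping.keys f \<subseteq> ?A"
    "Poly_Mapping.keys g \<subseteq> ?A" using keys_add[of f g] by auto
  show ?thesis
    unfolding A(2-4)[THEN sum_keys_superset[OF assms A(1)]]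
    by (simp add: lookup_add scale_left_distrib sum.distrib)
qed

lemma sum_keys_word_scale:
  assumes "vector_space sv"
  shows "(\<Sum>u\<in>Poly_Mapping.keys (word_scale c f). sv (Poly_Mapping.lookup (word_scale c f) u) (\<phi> u))
       = sv c (\<Sum>u\<in>Poly_Mapping.keys f. sv (Poly_Mapping.lookup f u) (\<phi> u))"
proof -
  interpret vector_space sv by fact
  have "Poly_Mapping.keys (word_scale c f) \<subseteq> Poly_Mapping.keys f"
    by (auto simp: in_keys_iff lookup_word_scale)
  from sum_keys_superset[OF assms finite_keys this] show ?thesis
    by (simp add: lookup_word_scale scale_sum_right)
qed

lemma sum_keys_single:
  assumes "vector_space sv"
  shows "(\<Sum>u\<in>Poly_Mapping.keys (Poly_Mapping.single w c).
            sv (Poly_Mapping.lookup (Poly_Mapping.single w c) u) (\<phi> u)) = sv c (\<phi> w)"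
proof -
  interpret vector_space sv by fact
  show ?thesis by simp
qed

lemma sum_keys_diff:
  assumes "vector_space sv"
  shows "(\<Sum>u\<in>Poly_Mapping.keys (f - g). sv (Poly_Mapping.lookup (f - g) u) (\<phi> u))
       = (\<Sum>u\<in>Poly_Mapping.keys f. sv (Poly_Mapping.lookup f u) (\<phi> u))
       - (\<Sum>u\<in>Poly_Mapping.keys g. sv (Poly_Mapping.lookup g u) (\<phi> u))"
  using sum_keys_add[OF assms, of "f - g" g \<phi>] by (simp add: algebra_simps)

text \<open>
  Functionals on the symmetric algebra are represented by functions on words.  The operator below is
  dual to the derivation that sends each letter \<open>y\<close> to the scalar \<open>q y\<close>.
\<close>

primrec annihilate :: "('g \<Rightarrow> complex) \<Rightarrow> ('g list \<Rightarrow> complex) \<Rightarrow> 'g list \<Rightarrow> complex" where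
  "annihilate q g [] = 0"
| "annihilate q g (y # m) = q y * g m + annihilate q (\<lambda>u. g (y # u)) m"

section \<open>Contractions of functionals and the action of letters on them\<close>

lemma annihilate_lin:
  "annihilate q (\<lambda>u. a * g u + b * h u) m = a * annihilate q g m + b * annihilate q h m"
  by (induction m arbitrary: g h) (simp_all add: algebra_simps)

lemma annihilate_add: "annihilate q (\<lambda>u. g u + h u) m = annihilate q g m + annihilate q h m"
  using annihilate_lin[of q 1 g 1 h m] by simp

lemma annihilate_scale: "annihilate q (\<lambda>u. a * g u) m = a * annihilate q g m"
  using annihilate_lin[of q a g 0 g m] by simp

lemma annihilate_zero: "annihilate q (\<lambda>u. 0) m = 0"
  by (induction m) simp_all

text \<open>Both sides sum over ordered pairs of distinct positions of \<open>m\<close>, one deleted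
  with weight \<open>q\<close>, the other with weight \<open>r\<close>.\<close>

lemma annihilate_commute: "annihilate q (annihilate r g) m = annihilate r (annihilate q g) m"
  by (induction m arbitrary: g) (simp_all add: annihilate_add annihilate_scale)

lemma annihilate_left_add:
  "annihilate (\<lambda>y. q y + r y) g m = annihilate q g m + annihilate r g m"
  by (induction m arbitrary: g) (simp_all add: algebra_simps)

lemma annihilate_left_scale: "annihilate (\<lambda>y. c * q y) g m = c * annihilate q g m"
  by (induction m arbitrary: g) (simp_all add: algebra_simps)

lemma annihilate_left_zero: "annihilate (\<lambda>y. 0) g m = 0"
  by (induction m arbitrary: g) simp_all

text \<open>\<open>\<psi> x y\<close> plays the role of the contraction \<open>\<langle>x y\<rangle>\<close> and \<open>z x\<close> that of \<open>\<langle>x\<rangle>\<close>.\<close>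

locale vacuum_pairing =
  fixes sg :: "complex \<Rightarrow> 'g::ab_group_add \<Rightarrow> 'g" and br :: "'g \<Rightarrow> 'g \<Rightarrow> 'g"
    and z :: "'g \<Rightarrow> complex" and \<psi> :: "'g \<Rightarrow> 'g \<Rightarrow> complex"
  assumes z_add: "z (x + y) = z x + z y" and z_scale: "z (sg c x) = c * z x"
    and left_add: "\<psi> (x + y) w = \<psi> x w + \<psi> y w" and left_scale: "\<psi> (sg c x) w = c * \<psi> x w"
    and right_add: "\<psi> w (x + y) = \<psi> w x + \<psi> w y" and right_scale: "\<psi> w (sg c x) = c * \<psi> w x"
    and z_bracket: "z (br x y) = \<psi> x y - \<psi> y x"
    and left_bracket: "\<psi> (br x y) w = 0" and right_bracket: "\<psi> w (br x y) = 0"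
begin

text \<open>The elements without creation part.\<close>

definition null :: "'g \<Rightarrow> bool" where "null x \<longleftrightarrow> (\<forall>w. \<psi> w x = 0)"

text \<open>These are the functions on words that descend to linear functionals on the symmetric
  algebra of the letters modulo the \<open>null\<close> ones. Adjacent swaps generate all
  permutations.\<close>

definition admissible :: "('g list \<Rightarrow> complex) \<Rightarrow> bool" where
  "admissible g \<longleftrightarrow>
     (\<forall>u v x y. g (u @ (x + y) # v) = g (u @ x # v) + g (u @ y # v)) \<and>
     (\<forall>u v c x. g (u @ sg c x # v) = c * g (u @ x # v)) \<and>
     (\<forall>u v x y. g (u @ x # y # v) = g (u @ y # x # v)) \<and>
     (\<forall>u v x. null x \<longrightarrow> g (u @ x # v) = 0)"

lemma admissibleD:
  assumes "admissible g"
  shows "g (u @ (x + y) # v) = g (u @ x # v) + g (u @ y # v)"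
    "g (u @ sg c x # v) = c * g (u @ x # v)"
    "g (u @ x # y # v) = g (u @ y # x # v)"
    "null x \<Longrightarrow> g (u @ x # v) = 0"
  using assms unfolding admissible_def by blast+

lemmas admissible_headD = admissibleD[where u = "[]", simplified]

lemma admissible_Cons:
  assumes "admissible g"
  shows "admissible (\<lambda>m. g (a # m))"
  unfolding admissible_def append_Cons[symmetric] using admissibleD[OF assms] by blast

lemma admissible_add: "admissible g \<Longrightarrow> admissible h \<Longrightarrow> admissible (\<lambda>m. g m + h m)"
  unfolding admissible_def by (auto simp: algebra_simps)

lemma admissible_scale: "admissible g \<Longrightarrow> admissible (\<lambda>m. a * g m)"
  unfolding admissible_def by (auto simp: algebra_simps)

text \<open>A contraction either removes the letter in question, and then linearity of
  \<open>\<psi> a\<close> applies, or another one, and then the property of \<open>g\<close>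
  applies. The inductions run over all admissible \<open>g\<close>, because peeling off
  \<open>b\<close> replaces \<open>g\<close> by its restriction to words starting with
  \<open>b\<close>.\<close>

lemma admissible_annihilate:
  assumes "admissible g"
  shows "admissible (annihilate (\<psi> a) g)"
proof -
  have "annihilate (\<psi> a) g (u @ (x + y) # v)
      = annihilate (\<psi> a) g (u @ x # v) + annihilate (\<psi> a) g (u @ y # v)" for u v x y
    using assms
  proof (induction u arbitrary: g)
    case Nil
    then show ?case by (simp add: admissible_headD annihilate_add right_add algebra_simps)
  next
    case (Cons b u)
    show ?case using Cons.IH[OF admissible_Cons[OF Cons.prems, of b]] Cons.prems
      by (simp add: admissibleD(1) algebra_simps)
  qed
  moreover have "annihilate (\<psi> a) g (u @ sg c x # v) = c * annihilate (\<psi> a) g (u @ x # v)" for u v c x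
    using assms
  proof (induction u arbitrary: g)
    case Nil
    then show ?case by (simp add: admissible_headD annihilate_scale right_scale algebra_simps)
  next
    case (Cons b u)
    show ?case using Cons.IH[OF admissible_Cons[OF Cons.prems, of b]] Cons.prems
      by (simp add: admissibleD(2) algebra_simps)
  qed
  moreover have "annihilate (\<psi> a) g (u @ x # y # v) = annihilate (\<psi> a) g (u @ y # x # v)" for u v x y
    using assms
  proof (induction u arbitrary: g)
    case Nil
    have "(\<lambda>m. g (x # y # m)) = (\<lambda>m. g (y # x # m))"
      using Nil by (simp add: fun_eq_iff admissible_headD(3)[of g x y])
    then show ?case by simp
  next
    case (Cons b u)
    show ?case using Cons.IH[OF admissible_Cons[OF Cons.prems, of b]] Cons.prems
      by (simp add: admissibleD(3)[of g u x y v])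
  qed
  moreover have "annihilate (\<psi> a) g (u @ x # v) = 0" if "null x" for u v x
    using assms
  proof (induction u arbitrary: g)
    case Nil
    have "(\<lambda>m. g (x # m)) = (\<lambda>m. 0)" using Nil that by (simp add: admissible_headD)
    then show ?case using that by (simp add: annihilate_zero null_def)
  next
    case (Cons b u)
    show ?case using Cons.IH[OF admissible_Cons[OF Cons.prems, of b]] Cons.prems that
      by (simp add: admissibleD(4))
  qed
  ultimately show ?thesis unfolding admissible_def by blast
qed

text \<open>The dual of the operator by which \<open>x\<close> acts on the symmetric algebra: the
  scalar \<open>z x\<close>, plus the derivation sending \<open>y\<close> to
  \<open>\<psi> x y\<close>, plus multiplication by \<open>x\<close>.\<close>

definition act :: "('g list \<Rightarrow> complex) \<Rightarrow> 'g \<Rightarrow> 'g list \<Rightarrow> complex" where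
  "act g x = (\<lambda>m. z x * g m + annihilate (\<psi> x) g m + g (x # m))"

lemma admissible_act: "admissible g \<Longrightarrow> admissible (act g x)"
  unfolding act_def
  by (intro admissible_add admissible_scale admissible_annihilate admissible_Cons)

lemma admissible_foldl: "admissible g \<Longrightarrow> admissible (foldl act g u)"
  by (induction u arbitrary: g) (simp_all add: admissible_act)

lemma act_lin: "act (\<lambda>m. a * g m + b * h m) x = (\<lambda>m. a * act g x m + b * act h x m)"
  by (simp add: act_def annihilate_lin algebra_simps)

lemma foldl_act_lin:
  "foldl act (\<lambda>m. a * g m + b * h m) u = (\<lambda>m. a * foldl act g u m + b * foldl act h u m)"
  by (induction u arbitrary: g h) (simp_all add: act_lin)

lemma foldl_act_add:
  "foldl act (\<lambda>m. g m + h m) u = (\<lambda>m. foldl act g u m + foldl act h u m)"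
  using foldl_act_lin[of 1 g 1 h u] by simp

lemma foldl_act_scale: "foldl act (\<lambda>m. a * g m) u = (\<lambda>m. a * foldl act g u m)"
  using foldl_act_lin[of a g 0 g u] by simp

lemma foldl_act_diff:
  "foldl act (\<lambda>m. g m - h m) u = (\<lambda>m. foldl act g u m - foldl act h u m)"
  using foldl_act_lin[of 1 g "- 1" h u] by simp

lemma act_add:
  assumes "admissible g"
  shows "act g (x + y) = (\<lambda>m. act g x m + act g y m)"
proof -
  have "\<psi> (x + y) = (\<lambda>w. \<psi> x w + \<psi> y w)" by (simp add: fun_eq_iff left_add)
  then show ?thesis
    using assms unfolding act_def by (simp add: annihilate_left_add z_add admissible_headD algebra_simps)
qed

lemma act_scale:
  assumes "admissible g"
  shows "act g (sg c x) = (\<lambda>m. c * act g x m)"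
proof -
  have "\<psi> (sg c x) = (\<lambda>w. c * \<psi> x w)" by (simp add: fun_eq_iff left_scale)
  then show ?thesis
    using assms unfolding act_def by (simp add: annihilate_left_scale z_scale admissible_headD algebra_simps)
qed

text \<open>In the commutator all terms cancel except those where one of \<open>x\<close>,
  \<open>y\<close> is contracted with the other; they leave \<open>\<psi> x y - \<psi> y x\<close>.
  The bracket acts by the same scalar, being null and having no contractions.\<close>

lemma act_bracket:
  assumes "admissible g"
  shows "act g (br x y) = (\<lambda>m. act (act g x) y m - act (act g y) x m)"
proof
  fix m
  have n: "null (br x y)" by (simp add: null_def right_bracket)
  have "\<psi> (br x y) = (\<lambda>w. 0)" by (simp add: fun_eq_iff left_bracket)
  then have "act g (br x y) m = (\<psi> x y - \<psi> y x) * g m"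
    using assms n by (simp add: act_def z_bracket annihilate_left_zero admissible_headD)
  moreover have "g (x # y # m) = g (y # x # m)" using assms by (rule admissible_headD)
  ultimately show "act g (br x y) m = act (act g x) y m - act (act g y) x m"
    using annihilate_commute[of "\<psi> x" "\<psi> y" g m]
    by (simp add: act_def annihilate_add annihilate_scale) (simp add: algebra_simps)
qed

definition vacuum :: "'g list \<Rightarrow> complex" where "vacuum m = (if m = [] then 1 else 0)"

lemma admissible_vacuum: "admissible vacuum"
  by (simp add: admissible_def vacuum_def)

text \<open>The matrix coefficient of \<open>u\<close> between the projection to the constants and
  the constant 1, represented by the empty word.\<close>

definition vev :: "'g list \<Rightarrow> complex" where "vev u = foldl act vacuum u []"

lemma vev_Nil: "vev [] = 1" by (simp add: vev_def vacuum_def)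

lemma vev_add: "vev (u @ (x + y) # v) = vev (u @ x # v) + vev (u @ y # v)"
  by (simp add: vev_def act_add admissible_foldl admissible_vacuum foldl_act_add)

lemma vev_scale: "vev (u @ sg c x # v) = c * vev (u @ x # v)"
  by (simp add: vev_def act_scale admissible_foldl admissible_vacuum foldl_act_scale)

lemma vev_bracket: "vev (u @ br x y # v) = vev (u @ x # y # v) - vev (u @ y # x # v)"
  by (simp add: vev_def act_bracket admissible_foldl admissible_vacuum foldl_act_diff)

text \<open>The last letter acts directly on the constant 1: there is nothing to contract, and its
  creation part vanishes because it is null.\<close>

lemma vev_null: "null x \<Longrightarrow> vev (u @ [x]) = z x * vev u"
  using admissible_foldl[OF admissible_vacuum, of u]
  by (simp add: vev_def act_def admissible_headD)

text \<open>The linear extension \<open>\<Phi>\<close> of \<open>vev\<close> kills each of the four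
  families of relations, hence their span, but not the empty word.\<close>

lemma one_notin_span_induced_relations:
  assumes null: "\<And>x w. x \<in> B \<Longrightarrow> \<psi> w x = 0" and ch: "\<And>x. x \<in> B \<Longrightarrow> ch x = z x"
  shows "Poly_Mapping.single [] 1 \<notin> module.span word_scale (induced_relations sg br G B ch)"
proof
  define \<Phi> where "\<Phi> f = (\<Sum>u\<in>Poly_Mapping.keys f. Poly_Mapping.lookup f u * vev u)" for f
  have C: "vector_space ((*) :: complex \<Rightarrow> _)"
    by unfold_locales (simp_all add: algebra_simps)
  interpret W: vector_space "word_scale :: complex \<Rightarrow> ('g list \<Rightarrow>\<^sub>0 complex) \<Rightarrow> _"
    by (rule vector_space_word_scale)
  have diff: "\<Phi> (f - g) = \<Phi> f - \<Phi> g" for f g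
    unfolding \<Phi>_def by (rule sum_keys_diff[OF C])
  have single: "\<Phi> (Poly_Mapping.single u c) = c * vev u" for u c
    unfolding \<Phi>_def by (rule sum_keys_single[OF C])
  have "W.subspace {f. \<Phi> f = 0}"
    using sum_keys_add[OF C, of _ _ vev] sum_keys_word_scale[OF C, of _ _ vev]
    by (intro W.subspaceI) (auto simp: \<Phi>_def)
  moreover have "induced_relations sg br G B ch \<subseteq> {f. \<Phi> f = 0}"
    using vev_null null ch unfolding null_def
    by (auto simp: induced_relations_def Let_def diff single vev_add vev_scale vev_bracket)
  moreover assume "Poly_Mapping.single [] 1 \<in> W.span (induced_relations sg br G B ch)"
  ultimately have "\<Phi> (Poly_Mapping.single [] 1) = 0"
    using W.span_minimal by blast
  then show False by (simp add: single vev_Nil)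
qed

end

section \<open>Differential operators and their homogeneous components\<close>

text \<open>Acting by \<open>x\<close> prefixes \<open>x\<close> to each spanning monomial, so the
  span is stable; the other module laws are inherited.\<close>

lemma enveloping_orbit_lie_module:
  assumes "lie_module sg br G sv UNIV \<rho>"
  shows "lie_module sg br G sv (enveloping_orbit G sv \<rho> w) \<rho>"
proof -
  interpret V: vector_space sv using assms by (simp add: lie_module_def)
  let ?S = "{foldr \<rho> xs w | xs. set xs \<subseteq> G}"
  have "\<rho> x v \<in> V.span ?S" if x: "x \<in> G" and v: "v \<in> V.span ?S" for x v
  proof -
    have add: "\<rho> x (u + v) = \<rho> x u + \<rho> x v" and scale: "\<rho> x (sv c v) = sv c (\<rho> x v)" for u v c
      using assms x by (simp_all add: lie_module_def)
    have "V.subspace {v. \<rho> x v \<in> V.span ?S}"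
      using scale[of 0 0]
      by (intro V.subspaceI) (auto simp: add scale V.span_add V.span_scale V.span_zero)
    moreover have "?S \<subseteq> {v. \<rho> x v \<in> V.span ?S}"
    proof clarify
      fix xs assume "set xs \<subseteq> G"
      then have "\<rho> x (foldr \<rho> xs w) = foldr \<rho> (x # xs) w \<and> set (x # xs) \<subseteq> G" using x by simp
      then show "\<rho> x (foldr \<rho> xs w) \<in> V.span ?S" by (intro V.span_base) blast
    qed
    ultimately show ?thesis using v V.span_minimal by blast
  qed
  then show ?thesis
    using assms unfolding lie_module_def enveloping_orbit_def by simp
qed

lemma lookup_diffop_scale:
  "Poly_Mapping.lookup (diffop_scale c a) n = smult c (Poly_Mapping.lookup a n)"
  by (simp add: diffop_scale_def map.rep_eq when_def)

lemma diffop_mult_single: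
  "diffop_mult (Poly_Mapping.single m f) (Poly_Mapping.single n g) =
     Poly_Mapping.single (m + n) (pcompose f [:of_int n, 1:] * g)"
  by (simp add: diffop_mult_def)

definition component :: "int \<Rightarrow> diffop \<Rightarrow> diffop" where
  "component n a = Poly_Mapping.single n (Poly_Mapping.lookup a n)"

lemma component_add: "component n (a + b) = component n a + component n b"
  by (simp add: component_def lookup_add single_add)

lemma component_diff: "component n (a - b) = component n a - component n b"
  by (simp add: component_def lookup_minus single_diff)

lemma component_scale: "component n (diffop_scale c a) = diffop_scale c (component n a)"
  by (rule poly_mapping_eqI) (simp add: component_def lookup_diffop_scale lookup_single when_def)

text \<open>The index set may exceed the support of \<open>a\<close>, so that the two products in a
  bracket can share one set.\<close>

lemma component_diffop_mult:
  assumes "finite I" "Poly_Mapping.keys a \<subseteq> I"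
  shows "component N (diffop_mult a b) =
    (\<Sum>m\<in>I. diffop_mult (component m a) (component (N - m) b))"
proof -
  let ?h = "\<lambda>m n. pcompose (Poly_Mapping.lookup a m) [:of_int n, 1:] * Poly_Mapping.lookup b n"
  have inner: "(\<Sum>n\<in>Poly_Mapping.keys b. Poly_Mapping.lookup (Poly_Mapping.single (m + n) (?h m n)) N)
      = ?h m (N - m)" for m
  proof -
    have "(\<Sum>n\<in>Poly_Mapping.keys b. Poly_Mapping.lookup (Poly_Mapping.single (m + n) (?h m n)) N)
        = (\<Sum>n\<in>Poly_Mapping.keys b. if n = N - m then ?h m n else 0)"
      by (intro sum.cong) (auto simp: lookup_single when_def)
    also have "\<dots> = ?h m (N - m)" by (simp add: in_keys_iff)
    finally show ?thesis .
  qed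
  have "Poly_Mapping.lookup (diffop_mult a b) N = (\<Sum>m\<in>Poly_Mapping.keys a. ?h m (N - m))"
    unfolding diffop_mult_def lookup_sum inner ..
  also have "\<dots> = (\<Sum>m\<in>I. ?h m (N - m))"
    by (rule sum.mono_neutral_left) (use assms in \<open>auto simp: in_keys_iff\<close>)
  finally have "component N (diffop_mult a b) = Poly_Mapping.single N (\<Sum>m\<in>I. ?h m (N - m))"
    by (simp add: component_def)
  also have "\<dots> = (\<Sum>m\<in>I. Poly_Mapping.single N (?h m (N - m)))"
    by (induction I rule: infinite_finite_induct) (simp_all add: single_add)
  finally show ?thesis by (simp add: component_def diffop_mult_single)
qed

lemma component_diffop_bracket:
  obtains I where "finite I"
    "component N (diffop_bracket a b) =
      (\<Sum>m\<in>I. diffop_bracket (component m a) (component (N - m) b))"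
proof
  \<comment> \<open>The second product is summed over degrees of \<open>b\<close>. Its index set
    \<open>?J\<close> is the reflection of \<open>?I\<close>, so \<open>?I\<close> must also contain
    the reflected degrees of \<open>b\<close>.\<close>
  let ?I = "Poly_Mapping.keys a \<union> (\<lambda>n. N - n) ` Poly_Mapping.keys b"
  let ?J = "(\<lambda>n. N - n) ` ?I"
  have sub: "Poly_Mapping.keys b \<subseteq> ?J" by (force simp: image_iff)
  have "(\<Sum>n\<in>?J. diffop_mult (component n b) (component (N - n) a)) =
      (\<Sum>m\<in>?I. diffop_mult (component (N - m) b) (component m a))"
    by (subst sum.reindex) (auto simp: inj_on_def)
  then show "component N (diffop_bracket a b) =
      (\<Sum>m\<in>?I. diffop_bracket (component m a) (component (N - m) b))"
    unfolding diffop_bracket_def component_diff sum_subtractf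
    using component_diffop_mult[of ?I a N b] component_diffop_mult[OF _ sub, of N a] by simp
qed simp

lemma L_gen_single: "\<exists>f. L_gen n r = Poly_Mapping.single n f"
proof -
  have "diffop_scale c (Poly_Mapping.single n f) = Poly_Mapping.single n (smult c f)" for c f
    by (rule poly_mapping_eqI) (simp add: lookup_diffop_scale lookup_single when_def)
  then show ?thesis by (auto simp: L_gen_def D_power_def tD_def diffop_mult_single)
qed

text \<open>In degree 0 nothing is shifted, which leaves signed odd powers of D. These are linearly
  independent, so a functional can later be prescribed on them freely.\<close>

lemma L_gen_0: "L_gen 0 r = Poly_Mapping.single 0 (monom ((- 1) ^ (r + 1)) (2 * r + 1))"
  by (rule poly_mapping_eqI)
    (auto simp: L_gen_def D_power_def tD_def diffop_mult_single lookup_diffop_scale lookup_single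
      when_def pcompose_idR mult_monom smult_monom minus_monom mult_2)

lemma component_L_gen: "component N (L_gen n r) = (if N = n then L_gen n r else 0)"
  using L_gen_single[of n r] by (auto simp: component_def lookup_single when_def)

section \<open>The generating series of the weights\<close>

lemma subst_diff_nth: "subst_diff G $ a $ b = (- 1) ^ a * of_nat ((a + b) choose a) * G $ (a + b)"
proof -
  have pow: "((fps_const fps_X - fps_X :: complex fps fps) ^ n) $ a $ b =
      (if n = a + b then (- 1) ^ a * of_nat (n choose a) else 0)" for n
  proof -
    \<comment> \<open>With \<open>- fps_X\<close> first, the binomial index \<open>k\<close> counts
      the factors of the outer variable.\<close>
    have "(- fps_X + fps_const fps_X :: complex fps fps) ^ n =
       (\<Sum>k\<le>n. fps_const (of_nat (n choose k) * (- 1) ^ k * fps_X ^ (n - k)) * fps_X ^ k)"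
      unfolding binomial_ring
      by (intro sum.cong refl)
        (simp add: fps_of_nat[symmetric] fps_const_power power_minus[of fps_X] mult.commute mult.left_commute
           flip: fps_const_mult fps_const_neg fps_const_power)
    then have "((fps_const fps_X - fps_X :: complex fps fps) ^ n) $ a =
       (\<Sum>k\<le>n. if k = a then of_nat (n choose k) * (- 1) ^ k * fps_X ^ (n - k) else 0)"
      by (simp add: fps_sum_nth fps_X_power_nth if_distrib cong: if_cong)
    also have "\<dots> = (if a \<le> n then of_nat (n choose a) * (- 1) ^ a * fps_X ^ (n - a) else 0)"
      by simp
    finally have "((fps_const fps_X - fps_X :: complex fps fps) ^ n) $ a =
      (if a \<le> n then fps_const (of_nat (n choose a) * (- 1) ^ a) * fps_X ^ (n - a) else 0)"
      by (simp add: fps_of_nat[symmetric] flip: fps_const_mult fps_const_neg fps_const_power)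
    then show ?thesis by auto
  qed
  show ?thesis by (simp add: subst_diff_def pow if_distrib cong: if_cong)
qed

text \<open>The derivative reaches the coefficient of index \<open>r + 1\<close> in the outer and
  \<open>r\<close> in the inner variable. The factorials combine with \<open>r + 1\<close> and the
  binomial coefficient to \<open>fact (2 * r + 1)\<close>; the \<open>r + 1\<close> negative factors
  give the sign.\<close>

lemma subst_diff_deriv_diagonal:
  fixes G :: "complex fps"
  shows "fact r * fact r * (1 / 2 * fps_nth (fps_nth (fps_deriv (subst_diff G)) r) r) =
    - ((- 1) ^ r * (fact (2 * r + 1) / 2 * fps_nth G (2 * r + 1)))"
proof -
  define B where "B = (of_nat ((2 * r + 1) choose (r + 1)) :: complex)"
  have coeff: "fps_nth (fps_nth (fps_deriv (subst_diff G)) r) r =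
      - ((- 1) ^ r * (of_nat (r + 1) * B) * fps_nth G (2 * r + 1))"
    unfolding B_def
    by (simp add: subst_diff_nth mult_2 fps_of_nat[symmetric] del: of_nat_Suc of_nat_add)
  have "B * fact (r + 1) * fact r = fact (2 * r + 1)"
    unfolding B_def using binomial_fact[of "r + 1" "2 * r + 1", where ?'a = complex]
    by (simp del: fact_Suc binomial_Suc_Suc add: field_simps)
  then have "fact (2 * r + 1) = fact r * fact r * (of_nat (r + 1) * B)"
    by (simp add: mult_ac del: of_nat_Suc)
  then show ?thesis unfolding coeff by simp
qed

text \<open>The divisor has subdegree 1. Hence the quotients in the character series are exact and
  can be cleared by multiplication.\<close>

lemma one_minus_fps_exp_dvd:
  fixes f :: "complex fps"
  assumes "f $ 0 = 0"
  shows "(1 - fps_exp 1) dvd f"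
proof (cases "f = 0")
  case False
  have "subdegree (1 - fps_exp 1 :: complex fps) = 1" by (rule subdegreeI) auto
  moreover have "subdegree f \<ge> 1" using assms False by (intro subdegree_geI) auto
  moreover have "(1 - fps_exp 1 :: complex fps) \<noteq> 0" using calculation by auto
  ultimately show ?thesis using False by (simp add: fps_dvd_iff)
qed simp

text \<open>Clear the denominator of G(-x) and multiply by e^x: the exponent -k/p becomes (p-k)/p,
  and \<open>sym\<close> turns the sum back into that of G. The result is G(x) + G(-x) +
  \<open>S\<close> = 0 with \<open>S\<close> constant.\<close>

lemma character_series_parity:
  fixes d :: "nat \<Rightarrow> nat" and p :: nat and G :: "complex fps"
  defines "G \<equiv> \<Sum>k<p. (fps_exp (of_nat k / of_nat p) - 1) * of_nat (d k) / (1 - fps_exp (1 :: complex))"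
  assumes p: "p > 0" and sym: "\<And>k. 0 < k \<Longrightarrow> k < p \<Longrightarrow> d (p - k) = d k" and n: "n > 0" "even n"
  shows "G $ n = 0"
proof -
  let ?u = "1 - fps_exp (1 :: complex)"
  let ?E = "\<lambda>k::nat. fps_exp (of_nat k / of_nat p :: complex)"
  let ?m = "fps_const (- 1 :: complex) * fps_X"
  define H where "H = G oo ?m"
  define S where "S = (\<Sum>k=1..<p. of_nat (d k) :: complex fps)"
  \<comment> \<open>The term k = 0 vanishes; it is split off because \<open>k\<close> to
    \<open>p - k\<close> permutes only 1, ..., p-1.\<close>
  have drop0: "{..<p} = insert 0 {1..<p}" using p by auto
  have "G * ?u = (\<Sum>k<p. (?E k - 1) * of_nat (d k))"
    unfolding G_def sum_distrib_right
    by (intro sum.cong refl dvd_div_mult_self one_minus_fps_exp_dvd) simp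
  then have G: "G * ?u = (\<Sum>k=1..<p. (?E k - 1) * of_nat (d k))"
    unfolding drop0 by simp
  have c0: "?m $ 0 = 0" by simp
  have "H * (1 - fps_exp (- 1)) = (G * ?u) oo ?m"
    unfolding H_def by (simp add: fps_compose_mult_distrib[OF c0] fps_compose_sub_distrib
      fps_exp_compose_linear)
  also have "\<dots> = (\<Sum>k=1..<p. (fps_exp (- (of_nat k / of_nat p)) - 1) * of_nat (d k))"
    unfolding G by (simp add: fps_compose_sum_distrib fps_compose_mult_distrib[OF c0]
      fps_compose_sub_distrib fps_exp_compose_linear fps_of_nat[symmetric])
  finally have "H * ((1 - fps_exp (- 1)) * fps_exp 1) =
      (\<Sum>k=1..<p. ((fps_exp (- (of_nat k / of_nat p)) - 1) * fps_exp 1) * of_nat (d k))"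
    by (simp add: sum_distrib_right mult.assoc[symmetric]) (simp add: mult_ac)
  also have "\<dots> = (\<Sum>k=1..<p. (?E (p - k) - 1) * of_nat (d k)) + S * ?u"
    unfolding S_def sum_distrib_right sum.distrib[symmetric]
  proof (intro sum.cong refl)
    fix k assume "k \<in> {1..<p}"
    then have "fps_exp (- (of_nat k / of_nat p)) * fps_exp 1 = ?E (p - k)"
      by (simp add: fps_exp_add_mult[symmetric] of_nat_diff diff_divide_distrib)
    then show "((fps_exp (- (of_nat k / of_nat p)) - 1) * fps_exp 1) * of_nat (d k) =
        (?E (p - k) - 1) * of_nat (d k) + of_nat (d k) * ?u"
      by (simp add: algebra_simps)
  qed
  also have "(\<Sum>k=1..<p. (?E (p - k) - 1) * of_nat (d k)) = (\<Sum>k=1..<p. (?E k - 1) * of_nat (d k))"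
    by (rule sum.reindex_bij_witness[of _ "\<lambda>k. p - k" "\<lambda>k. p - k"]) (auto simp: sym)
  also have "(1 - fps_exp (- 1)) * fps_exp (1 :: complex) = - ?u"
    by (simp add: algebra_simps fps_exp_add_mult[symmetric])
  finally have "(H + G + S) * ?u = 0" unfolding G[symmetric] by (simp add: algebra_simps)
  moreover have "?u \<noteq> 0"
  proof
    assume "?u = 0"
    then have "?u $ 1 = 0" by (simp only: fps_zero_nth)
    then show False by simp
  qed
  ultimately have "(H + G + S) $ n = 0" by simp
  moreover have "S $ n = 0" using n by (simp add: S_def fps_sum_nth fps_of_nat[symmetric])
  moreover have "H $ n = G $ n" using n by (simp add: H_def fps_compose_linear)
  ultimately show ?thesis by simp
qed

section \<open>Eigenspaces of the isometry\<close>

text \<open>A \<open>Sum_any\<close> with infinite support is 0 by convention, so the sum lies in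
  the subspace in every case.\<close>

lemma (in module) Sum_any_in_subspace: "subspace S \<Longrightarrow> (\<And>k. f k \<in> S) \<Longrightarrow> Sum_any f \<in> S"
  unfolding Sum_any.expand_set by (rule subspace_sum)

text \<open>A geometric sum with ratio \<open>\<zeta>\<close>, a p-th root of unity. Reducing
  \<open>m\<close> modulo \<open>p\<close> shows that \<open>\<zeta>\<close> is 1 exactly when
  \<open>p\<close> divides \<open>m\<close>.\<close>

lemma sum_primitive_root_powi:
  assumes "primitive_root_of_unity p \<omega>" "p > 0"
  shows "(\<Sum>j<p. \<omega> powi (m * int j)) = (if int p dvd m then of_nat p else 0)"
proof -
  have one: "\<omega> ^ p = 1" and prim: "\<And>k. 0 < k \<Longrightarrow> k < p \<Longrightarrow> \<omega> ^ k \<noteq> 1"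
    using assms(1) by (auto simp: primitive_root_of_unity_def)
  have "\<omega> \<noteq> 0" using one assms(2) by (auto simp: power_0_left)
  define \<zeta> where "\<zeta> = \<omega> powi m"
  have \<zeta>: "\<omega> powi (m * int j) = \<zeta> ^ j" for j
    by (simp add: \<zeta>_def power_int_mult)
  have "\<zeta> ^ p = 1"
  proof -
    have "\<zeta> ^ p = \<omega> powi (int p * m)" by (simp add: \<zeta>[symmetric] mult.commute)
    also have "\<dots> = 1" by (simp add: power_int_mult one)
    finally show ?thesis .
  qed
  have mod: "\<zeta> = \<omega> ^ nat (m mod int p)"
  proof -
    have "\<zeta> = \<omega> powi (int p * (m div int p) + m mod int p)" by (simp add: \<zeta>_def)
    also have "\<dots> = \<omega> powi (m mod int p)"
      using \<open>\<omega> \<noteq> 0\<close> by (subst power_int_add) (simp_all add: power_int_mult one)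
    finally show ?thesis using assms(2) by (simp add: power_int_def)
  qed
  show ?thesis
  proof (cases "int p dvd m")
    case True
    then have "\<zeta> = 1" unfolding mod by simp
    then show ?thesis using True unfolding \<zeta> by simp
  next
    case False
    then have "m mod int p \<noteq> 0" by (simp add: mod_eq_0_iff_dvd)
    moreover have "m mod int p \<ge> 0" "m mod int p < int p" using assms(2) by simp_all
    ultimately have "m mod int p > 0" "m mod int p < int p" by linarith+
    then have "\<zeta> \<noteq> 1" unfolding mod by (intro prim) auto
    then have "(\<Sum>j<p. \<zeta> ^ j) = 0"
      using \<open>\<zeta> ^ p = 1\<close> by (simp add: geometric_sum)
    then show ?thesis using False unfolding \<zeta> by simp
  qed
qed

lemma powi_cong_mod:
  assumes "primitive_root_of_unity p \<omega>" "p > 0" "int p dvd k - l"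
  shows "\<omega> powi k = \<omega> powi l"
proof -
  have one: "\<omega> ^ p = 1" using assms(1) by (auto simp: primitive_root_of_unity_def)
  then have "\<omega> \<noteq> 0" using assms(2) by (auto simp: power_0_left)
  obtain c where "k = l + int p * c" using assms(3) by (metis add_diff_cancel_left' diff_add_cancel dvdE add.commute)
  then show ?thesis using \<open>\<omega> \<noteq> 0\<close> by (simp add: power_int_add power_int_mult one)
qed

locale twisted_module =
  fixes hs :: "complex \<Rightarrow> 'h::ab_group_add \<Rightarrow> 'h"
    and form :: "'h \<Rightarrow> 'h \<Rightarrow> complex"
    and \<nu> :: "'h \<Rightarrow> 'h" and p :: nat and \<omega> :: complex
    and Q :: "'h set"
    and sv :: "complex \<Rightarrow> 'v::ab_group_add \<Rightarrow> 'v"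
    and \<pi> :: "'h heis \<Rightarrow> 'v \<Rightarrow> 'v" and e :: 'v
    and \<rho> :: "dhat \<Rightarrow> 'v \<Rightarrow> 'v"
  assumes form: "nondegenerate_symmetric_form hs form"
    and p: "p > 0" and isometry: "isometry_of_period hs form \<nu> p"
    and \<omega>: "primitive_root_of_unity p \<omega>"
    and Q: "orthonormal_basis hs form Q"
    and twisted_space: "twisted_space hs form \<nu> p \<omega> sv \<pi> e"
    and twisted_action: "twisted_action hs \<nu> p \<omega> Q sv \<pi> \<rho>"
begin

sublocale H: finite_dimensional_vector_space hs Q
  using Q by (simp add: orthonormal_basis_def)

sublocale V: vector_space sv
  using twisted_action by (simp add: twisted_action_def lie_module_def)

sublocale \<nu>: Vector_Spaces.linear hs hs \<nu>
  using isometry by (simp add: isometry_of_period_def)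

sublocale form: Vector_Spaces.linear hs "(*)" "form x" for x
  using form by (simp add: nondegenerate_symmetric_form_def)

lemma form_sym: "form x y = form y x"
  using form by (simp add: nondegenerate_symmetric_form_def)

lemma form_nondegenerate: "(\<And>y. form x y = 0) \<Longrightarrow> x = 0"
  using form by (simp add: nondegenerate_symmetric_form_def)

lemma form_left: "form (x + y) w = form x w + form y w" "form (hs c x) w = c * form x w"
  "form 0 w = 0"
  using form.add[of w x y] form.scale[of w c x] form.zero[of w] by (simp_all add: form_sym[of _ w])

lemma form_\<nu>: "form (\<nu> x) (\<nu> y) = form x y"
  using isometry by (simp add: isometry_of_period_def)

lemma \<nu>_power_p: "(\<nu> ^^ p) x = x"
  using isometry by (simp add: isometry_of_period_def)

lemma \<omega>_nonzero: "\<omega> \<noteq> 0"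
  using \<omega> p by (auto simp: primitive_root_of_unity_def power_0_left)

abbreviation eig :: "int \<Rightarrow> 'h set" where "eig \<equiv> eigen_part hs \<nu> \<omega>"

lemma eig_subspace: "H.subspace (eig k)"
  by (rule H.subspaceI)
    (auto simp: eigen_part_def \<nu>.zero \<nu>.add \<nu>.scale H.scale_right_distrib H.scale_left_commute)

lemma eig_cong: "int p dvd k - l \<Longrightarrow> eig k = eig l"
  using powi_cong_mod[OF \<omega> p] by (simp add: eigen_part_def)

text \<open>The averaging projection onto \<open>eig r\<close> over the cyclic group generated by
  \<open>\<nu>\<close>. It makes the definite description in \<open>eigen_proj\<close>
  explicit.\<close>

definition fourier :: "int \<Rightarrow> 'h \<Rightarrow> 'h" where
  "fourier r \<alpha> = hs (1 / of_nat p) (\<Sum>j<p. hs (\<omega> powi (- r * int j)) ((\<nu> ^^ j) \<alpha>))"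

lemma \<nu>_funpow_eig: "\<alpha> \<in> eig k \<Longrightarrow> (\<nu> ^^ j) \<alpha> = hs (\<omega> powi (k * int j)) \<alpha>"
proof (induction j)
  case (Suc j)
  then have "(\<nu> ^^ Suc j) \<alpha> = hs (\<omega> powi (k * int j)) (\<nu> \<alpha>)"
    by (simp add: \<nu>.scale)
  also have "\<dots> = hs (\<omega> powi (k * int j) * \<omega> powi k) \<alpha>"
    using Suc.prems by (simp add: eigen_part_def)
  also have "\<omega> powi (k * int j) * \<omega> powi k = \<omega> powi (k * int (Suc j))"
    using \<omega>_nonzero by (simp add: power_int_add[symmetric] algebra_simps)
  finally show ?case .
qed simp

lemma fourier_eig:
  assumes "\<alpha> \<in> eig k"
  shows "fourier r \<alpha> = (if int p dvd k - r then \<alpha> else 0)"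
proof -
  have "fourier r \<alpha> = hs (1 / of_nat p * (\<Sum>j<p. \<omega> powi ((k - r) * int j))) \<alpha>"
    using \<omega>_nonzero
    by (simp add: fourier_def \<nu>_funpow_eig[OF assms] power_int_add[symmetric] algebra_simps
        flip: H.scale_sum_left)
  then show ?thesis using p by (simp add: sum_primitive_root_powi[OF \<omega> p])
qed

lemma linear_funpow_\<nu>: "(\<nu> ^^ j) (x + y) = (\<nu> ^^ j) x + (\<nu> ^^ j) y" "(\<nu> ^^ j) 0 = 0"
  by (induction j) (simp_all add: \<nu>.add \<nu>.zero)

lemma fourier_add: "fourier r (x + y) = fourier r x + fourier r y"
  by (simp add: fourier_def linear_funpow_\<nu> H.scale_right_distrib sum.distrib)

lemma fourier_zero: "fourier r 0 = 0"
  by (simp add: fourier_def linear_funpow_\<nu>)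

lemma fourier_sum: "fourier r (\<Sum>i\<in>I. f i) = (\<Sum>i\<in>I. fourier r (f i))"
  by (induction I rule: infinite_finite_induct) (simp_all add: fourier_zero fourier_add)

text \<open>Applying \<open>\<nu>\<close> shifts the summation index cyclically at the cost of a
  factor \<open>\<omega> powi r\<close>.\<close>

lemma fourier_in_eig: "fourier r \<alpha> \<in> eig r"
proof -
  define g where "g j = hs (\<omega> powi (- r * int j)) ((\<nu> ^^ j) \<alpha>)" for j
  have "\<nu> (g j) = hs (\<omega> powi r) (g (Suc j))" for j
    using \<omega>_nonzero by (simp add: g_def \<nu>.scale power_int_add[symmetric] algebra_simps)
  then have "\<nu> (\<Sum>j<p. g j) = hs (\<omega> powi r) (\<Sum>j<p. g (Suc j))"
    by (simp add: \<nu>.sum H.scale_sum_right)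
  also have "(\<Sum>j<p. g (Suc j)) = (\<Sum>j<p. g j)"
  proof -
    have "\<omega> powi (- r * int p) = \<omega> powi 0" by (rule powi_cong_mod[OF \<omega> p]) simp
    then have "g p = g 0" by (simp add: g_def \<nu>_power_p)
    then show ?thesis
      using sum.lessThan_Suc_shift[of g p] by simp
  qed
  finally show ?thesis
    unfolding fourier_def eigen_part_def g_def[symmetric]
    by (simp add: \<nu>.scale H.scale_left_commute)
qed

lemma sum_fourier: "(\<Sum>r\<in>{0..<int p}. fourier r \<alpha>) = \<alpha>"
proof -
  have img: "{0..<int p} = int ` {..<p}"
    by (auto simp: image_iff) (metis lessThan_iff nat_less_iff nat_0_le)
  have "(\<Sum>r\<in>{0..<int p}. fourier r \<alpha>) = (\<Sum>r<p. fourier (int r) \<alpha>)"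
    unfolding img by (subst sum.reindex) auto
  also have "\<dots> = hs (1 / of_nat p) (\<Sum>j<p. hs (\<Sum>r<p. \<omega> powi (- int j * int r)) ((\<nu> ^^ j) \<alpha>))"
    unfolding fourier_def H.scale_sum_right[symmetric] H.scale_sum_left
    by (subst sum.swap) (simp add: mult.commute)
  also have "\<dots> = hs (1 / of_nat p) (\<Sum>j<p. if j = 0 then hs (of_nat p) \<alpha> else 0)"
    unfolding sum_primitive_root_powi[OF \<omega> p]
    by (intro arg_cong[where f = "hs _"] sum.cong) (auto dest: zdvd_imp_le)
  also have "\<dots> = \<alpha>" using p by simp
  finally show ?thesis .
qed

lemma eigen_proj_eq_fourier: "eigen_proj hs \<nu> \<omega> p r \<alpha> = fourier r \<alpha>"
  unfolding eigen_proj_def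
proof (rule the_equality)
  \<comment> \<open>Only the residue of the index matters: in \<open>fourier r\<close> applied to
    the decomposition of \<open>\<alpha>\<close>, just the summand \<open>k = r mod int p\<close>
    survives.\<close>
  have "fourier (r mod int p) \<alpha> = (\<Sum>k\<in>{0..<int p}. fourier r (fourier k \<alpha>))"
    using p by (simp add: fourier_eig[OF fourier_in_eig])
      (subst sum.mono_neutral_right[of _ "{r mod int p}"];
       auto simp: mod_eq_dvd_iff[symmetric])
  then have "fourier (r mod int p) \<alpha> = fourier r \<alpha>"
    unfolding fourier_sum[symmetric] sum_fourier .
  then show "\<exists>f. (\<forall>k\<in>{0..<int p}. f k \<in> eig k) \<and> (\<Sum>k\<in>{0..<int p}. f k) = \<alpha> \<and>
      f (r mod int p) = fourier r \<alpha>"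
    using fourier_in_eig sum_fourier by (intro exI[of _ "\<lambda>k. fourier k \<alpha>"]) auto
next
  fix \<beta>
  assume "\<exists>f. (\<forall>k\<in>{0..<int p}. f k \<in> eig k) \<and> (\<Sum>k\<in>{0..<int p}. f k) = \<alpha> \<and> f (r mod int p) = \<beta>"
  then obtain f where f: "\<And>k. k \<in> {0..<int p} \<Longrightarrow> f k \<in> eig k" "(\<Sum>k\<in>{0..<int p}. f k) = \<alpha>"
    "f (r mod int p) = \<beta>" by blast
  have "fourier r \<alpha> = (\<Sum>k\<in>{0..<int p}. fourier r (f k))"
    by (simp add: fourier_sum f(2)[symmetric])
  also have "\<dots> = (\<Sum>k\<in>{0..<int p}. if int p dvd k - r then f k else 0)"
    using f(1) fourier_eig by (intro sum.cong) auto
  also have "\<dots> = (\<Sum>k\<in>{0..<int p}. if k = r mod int p then f k else 0)"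
    using p by (intro sum.cong) (auto simp: mod_eq_dvd_iff[symmetric])
  also have "\<dots> = \<beta>" using p f(3) by simp
  finally show "\<beta> = fourier r \<alpha>" by simp
qed

text \<open>Invariance under \<open>\<nu>\<close> multiplies the value by
  \<open>\<omega> powi (k + l)\<close>, which is not 1.\<close>

lemma form_eig_eq_zero:
  assumes "x \<in> eig k" "y \<in> eig l" "\<not> int p dvd k + l"
  shows "form x y = 0"
proof -
  have "form (\<nu> x) (\<nu> y) = \<omega> powi (k + l) * form x y"
    using assms(1,2) \<omega>_nonzero by (simp add: eigen_part_def form_left form.scale power_int_add)
  then have "form x y = 0 \<or> \<omega> powi (k + l) = 1" by (simp add: form_\<nu>)
  moreover have "\<omega> powi (k + l) \<noteq> 1"
  proof
    assume "\<omega> powi (k + l) = 1"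
    then have "(\<Sum>j<p. \<omega> powi ((k + l) * int j)) = of_nat p" by (simp add: power_int_mult)
    then show False using assms(3) p by (simp add: sum_primitive_root_powi[OF \<omega> p])
  qed
  ultimately show ?thesis by blast
qed

text \<open>The form embeds \<open>eig k\<close> into the dual of \<open>eig (- k)\<close>: all
  other eigenspaces are orthogonal to \<open>eig k\<close>, and the form is nondegenerate.\<close>

lemma dim_eig_le: "H.dim (eig k) \<le> H.dim (eig (- k))"
proof -
  obtain C where C: "C \<subseteq> eig (- k)" "H.independent C" "eig (- k) \<subseteq> H.span C"
    by (rule H.basis_exists)
  have fin: "finite C" using C(2) by (rule H.finiteI_independent)
  \<comment> \<open>The functional \<open>form x\<close> on \<open>eig (- k)\<close> is encoded as a
    vector, with its values on the basis \<open>C\<close> as coordinates.\<close>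
  define T where "T x = (\<Sum>c\<in>C. hs (form x c) c)" for x
  interpret T: Vector_Spaces.linear hs hs T
    by unfold_locales
      (simp_all add: T_def form_left H.scale_left_distrib sum.distrib H.scale_sum_right
        H.scale_right_distrib)
  have zero: "x = 0" if x: "x \<in> eig k" "T x = 0" for x
  proof (rule form_nondegenerate)
    fix y
    have c: "form x c = 0" if "c \<in> C" for c
      using H.independentD[OF C(2) fin order.refl, of "form x"] x(2) that by (simp add: T_def)
    have "H.span C \<subseteq> {y. form x y = 0}"
      using c by (intro H.span_minimal H.subspaceI) (auto simp: form.add form.scale)
    then have m: "form x y = 0" if "y \<in> eig (- k)" for y using that C(3) by auto
    have "form x (fourier l y) = 0" for l
    proof (cases "int p dvd k + l")
      case True
      then have "eig l = eig (- k)" by (intro eig_cong) (simp add: add.commute)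
      then show ?thesis using m fourier_in_eig by blast
    next
      case False
      then show ?thesis by (rule form_eig_eq_zero[OF x(1) fourier_in_eig])
    qed
    then have "form x (\<Sum>l\<in>{0..<int p}. fourier l y) = 0" by (simp add: form.sum)
    then show "form x y = 0" by (simp add: sum_fourier)
  qed
  have sp: "H.span (eig k) = eig k" using eig_subspace by (simp add: H.span_eq_iff)
  have "inj_on T (eig k)"
  proof (rule inj_onI)
    fix x y assume "x \<in> eig k" "y \<in> eig k" "T x = T y"
    then have "x - y \<in> eig k" "T (x - y) = 0"
      using H.subspace_diff[OF eig_subspace] by (simp_all add: T.diff)
    then have "x - y = 0" by (rule zero)
    then show "x = y" by simp
  qed
  then have "H.dim (T ` eig k) = H.dim (eig k)"
    using finite_dimensional_vector_space_pair_1.dim_image_eq[of hs Q hs T "eig k"]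
    by (simp add: sp finite_dimensional_vector_space_pair_1_def H.finite_dimensional_vector_space_axioms
       H.vector_space_axioms T.linear_axioms)
  moreover have "T ` eig k \<subseteq> eig (- k)"
    using C(1) unfolding T_def
    by (intro image_subsetI H.subspace_sum[OF eig_subspace] H.subspace_scale[OF eig_subspace]) blast
  ultimately show ?thesis using H.dim_subset by metis
qed

lemma dim_eig_minus: "H.dim (eig (int p - k)) = H.dim (eig k)"
proof -
  have "eig (int p - k) = eig (- k)" by (rule eig_cong) simp
  then show ?thesis using dim_eig_le[of k] dim_eig_le[of "- k"] by simp
qed

subsection \<open>The twisted Fock space\<close>

abbreviation "hbr \<equiv> heis_bracket form p"
abbreviation "hsc \<equiv> heis_scale hs"
abbreviation "Heis \<equiv> heis hs \<nu> \<omega>"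
abbreviation "mode \<equiv> mode_op hs \<nu> p \<omega> \<pi>"

text \<open>The contraction of two Heisenberg elements: the part of the bracket in which
  annihilation modes of \<open>x\<close> meet creation modes of \<open>y\<close>.\<close>

definition wick :: "'h heis \<Rightarrow> 'h heis \<Rightarrow> complex" where
  "wick x y = (\<Sum>k\<in>Poly_Mapping.keys (snd x). if 0 < k then
     form (Poly_Mapping.lookup (snd x) k) (Poly_Mapping.lookup (snd y) (- k)) * (of_int k / of_nat p) else 0)"

lemma wick_superset:
  assumes "finite I" "Poly_Mapping.keys (snd x) \<subseteq> I"
  shows "wick x y = (\<Sum>k\<in>I. if 0 < k then
     form (Poly_Mapping.lookup (snd x) k) (Poly_Mapping.lookup (snd y) (- k)) * (of_int k / of_nat p) else 0)"
  unfolding wick_def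
  by (rule sum.mono_neutral_left) (use assms in \<open>auto simp: in_keys_iff form_left\<close>)

lemma heis_bracket_superset:
  assumes "finite I" "Poly_Mapping.keys (snd x) \<subseteq> I"
  shows "fst (hbr x y) = (\<Sum>k\<in>I.
     form (Poly_Mapping.lookup (snd x) k) (Poly_Mapping.lookup (snd y) (- k)) * (of_int k / of_nat p))"
  unfolding heis_bracket_def fst_conv
  by (rule sum.mono_neutral_left) (use assms in \<open>auto simp: in_keys_iff form_left\<close>)

lemma lookup_heis_scale:
  "Poly_Mapping.lookup (snd (hsc c x)) k = hs c (Poly_Mapping.lookup (snd x) k)"
  by (simp add: heis_scale_def map.rep_eq when_def)

lemma vacuum_pairing_wick: "vacuum_pairing hsc hbr fst wick"
proof
  fix x y w :: "'h heis" and c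
  show "fst (x + y) = fst x + fst y" by simp
  show "fst (hsc c x) = c * fst x" by (simp add: heis_scale_def)
  let ?I = "Poly_Mapping.keys (snd x) \<union> Poly_Mapping.keys (snd y)"
  have I: "finite ?I" "Poly_Mapping.keys (snd x) \<subseteq> ?I" "Poly_Mapping.keys (snd y) \<subseteq> ?I"
    "Poly_Mapping.keys (snd (x + y)) \<subseteq> ?I" using keys_add[of "snd x" "snd y"] by auto
  show "wick (x + y) w = wick x w + wick y w"
    unfolding I(2-4)[THEN wick_superset[OF I(1)]] sum.distrib[symmetric]
    by (intro sum.cong) (auto simp: lookup_add form_left algebra_simps)
  have "Poly_Mapping.keys (snd (hsc c x)) \<subseteq> Poly_Mapping.keys (snd x)"
    by (auto simp: in_keys_iff lookup_heis_scale)
  then show "wick (hsc c x) w = c * wick x w"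
    unfolding wick_def[of x] sum_distrib_left
    by (subst wick_superset[OF finite_keys]) (auto intro!: sum.cong simp: lookup_heis_scale form_left)
  show "wick w (x + y) = wick w x + wick w y"
    unfolding wick_def sum.distrib[symmetric]
    by (intro sum.cong) (auto simp: lookup_add form.add algebra_simps)
  show "wick w (hsc c x) = c * wick w x"
    unfolding wick_def sum_distrib_left
    by (intro sum.cong) (auto simp: lookup_heis_scale form.scale)
  show "wick (hbr x y) w = 0" "wick w (hbr x y) = 0"
    by (simp_all add: wick_def heis_bracket_def form.zero cong: if_cong)
  \<comment> \<open>A set symmetric under negation: reindexing \<open>wick y x\<close> by -k
    supplies the terms of the bracket with negative \<open>k\<close>.\<close>
  let ?J = "?I \<union> uminus ` ?I"
  have J: "finite ?J" "Poly_Mapping.keys (snd x) \<subseteq> ?J" "Poly_Mapping.keys (snd y) \<subseteq> ?J" by auto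
  have "bij_betw uminus ?J ?J" by (rule bij_betw_byWitness[where f' = uminus]) auto
  from sum.reindex_bij_betw[OF this]
  have y: "wick y x = (\<Sum>k\<in>?J. if 0 < - k then
     form (Poly_Mapping.lookup (snd y) (- k)) (Poly_Mapping.lookup (snd x) (- (- k)))
       * (of_int (- k) / of_nat p) else 0)"
    unfolding wick_superset[OF J(1,3)] by (rule sym)
  show "fst (hbr x y) = wick x y - wick y x"
    unfolding y wick_superset[OF J(1,2)] heis_bracket_superset[OF J(1,2)] sum_subtractf[symmetric]
    by (intro sum.cong) (auto simp: form_sym)
qed

lemma \<pi>_module: "lie_module hsc hbr Heis sv UNIV \<pi>"
  and word_apply_surj: "word_apply sv \<pi> e ` word_space Heis = UNIV"
  and word_apply_kernel: "{f \<in> word_space Heis. word_apply sv \<pi> e f = 0} =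
     module.span word_scale (induced_relations hsc hbr Heis (heis_nonneg hs \<nu> \<omega>) fst)"
  using twisted_space by (simp_all add: twisted_space_def induced_module_def)

lemma e_nonzero: "e \<noteq> 0"
proof
  assume "e = 0"
  then have "Poly_Mapping.single [] 1 \<in> {f \<in> word_space Heis. word_apply sv \<pi> e f = 0}"
    by (simp add: word_space_def word_apply_def)
  \<comment> \<open>\<open>wick\<close> sees only the negative modes of its second argument.\<close>
  moreover have "wick w x = 0" if "x \<in> heis_nonneg hs \<nu> \<omega>" for w x
    using that by (auto simp: wick_def heis_nonneg_def form.zero intro!: sum.neutral)
  ultimately show False
    using vacuum_pairing.one_notin_span_induced_relations[OF vacuum_pairing_wick,
        of "heis_nonneg hs \<nu> \<omega>" fst Heis]
    unfolding word_apply_kernel by blast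
qed

lemma heis_nonneg_vacuum:
  assumes x: "x \<in> heis_nonneg hs \<nu> \<omega>"
  shows "\<pi> x e = sv (fst x) e"
proof -
  interpret W: vector_space "word_scale :: complex \<Rightarrow> ('h heis list \<Rightarrow>\<^sub>0 complex) \<Rightarrow> _"
    by (rule vector_space_word_scale)
  let ?r = "Poly_Mapping.single ([] @ [x]) 1 - Poly_Mapping.single [] (fst x)"
  have "?r \<in> induced_relations hsc hbr Heis (heis_nonneg hs \<nu> \<omega>) fst"
    unfolding induced_relations_def Let_def
    by (rule UnI2, intro CollectI exI[of _ "[]"] exI[of _ x]) (use x in simp)
  then have "?r \<in> W.span (induced_relations hsc hbr Heis (heis_nonneg hs \<nu> \<omega>) fst)"
    by (rule W.span_base)
  then have "word_apply sv \<pi> e ?r = 0" unfolding word_apply_kernel[symmetric] by simp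
  moreover have "word_apply sv \<pi> e ?r = \<pi> x e - sv (fst x) e"
    unfolding word_apply_def
    unfolding sum_keys_diff[OF V.vector_space_axioms] sum_keys_single[OF V.vector_space_axioms]
    by simp
  ultimately show ?thesis by simp
qed

lemma \<pi>_add: "x \<in> Heis \<Longrightarrow> \<pi> x (v + w) = \<pi> x v + \<pi> x w"
  and \<pi>_scale: "x \<in> Heis \<Longrightarrow> \<pi> x (sv c v) = sv c (\<pi> x v)"
  and \<pi>_scale_left: "x \<in> Heis \<Longrightarrow> \<pi> (hsc c x) v = sv c (\<pi> x v)"
  and \<pi>_bracket: "x \<in> Heis \<Longrightarrow> y \<in> Heis \<Longrightarrow> \<pi> (hbr x y) v = \<pi> x (\<pi> y v) - \<pi> y (\<pi> x v)"
  using \<pi>_module by (simp_all add: lie_module_def)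

lemma \<pi>_zero_right: "x \<in> Heis \<Longrightarrow> \<pi> x 0 = 0"
  using \<pi>_scale[of x 0 0] by simp

lemma zero_in_eig: "0 \<in> eig k"
  by (rule H.subspace_0[OF eig_subspace])

lemma central_in_heis: "(c, 0) \<in> Heis"
  by (simp add: heis_def zero_in_eig)

lemma \<pi>_zero_left: "\<pi> 0 v = 0"
proof -
  have "hsc 0 (0, 0) = 0"
    by (intro prod_eqI poly_mapping_eqI) (simp_all add: lookup_heis_scale, simp add: heis_scale_def)
  then show ?thesis using \<pi>_scale_left[OF central_in_heis, of 0 0 v] by simp
qed

text \<open>Central elements commute with every word, so the scalar by which they act on
  \<open>e\<close>, given by the character, is the same on all of the module.\<close>

lemma \<pi>_central: "\<pi> (c, 0) v = sv c v"
proof -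
  have word: "\<pi> (c, 0) (foldr \<pi> u e) = sv c (foldr \<pi> u e)" if "set u \<subseteq> Heis" for u
    using that
  proof (induction u)
    case Nil
    have "(c, 0) \<in> heis_nonneg hs \<nu> \<omega>" using central_in_heis by (simp add: heis_nonneg_def)
    then show ?case using heis_nonneg_vacuum by simp
  next
    case (Cons x u)
    have "hbr (c, 0) x = 0" by (simp add: heis_bracket_def zero_prod_def)
    then have "\<pi> (c, 0) (\<pi> x (foldr \<pi> u e)) = \<pi> x (\<pi> (c, 0) (foldr \<pi> u e))"
      using \<pi>_bracket[OF central_in_heis, of x c "foldr \<pi> u e"] Cons.prems by (simp add: \<pi>_zero_left)
    then show ?case using Cons by (simp add: \<pi>_scale)
  qed
  obtain f where f: "f \<in> word_space Heis" "v = word_apply sv \<pi> e f"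
    using word_apply_surj by blast
  have S: "V.subspace {v. \<pi> (c, 0) v = sv c v}"
    by (rule V.subspaceI)
      (simp_all add: \<pi>_zero_right \<pi>_add \<pi>_scale central_in_heis V.scale_right_distrib V.scale_left_commute)
  have "word_apply sv \<pi> e f \<in> {v. \<pi> (c, 0) v = sv c v}"
    unfolding word_apply_def
    using f(1) word by (intro V.subspace_sum[OF S] V.subspace_scale[OF S]) (auto simp: word_space_def)
  then show ?thesis using f by simp
qed

lemma mode_in_heis: "(0, Poly_Mapping.single k (eigen_proj hs \<nu> \<omega> p k \<alpha>)) \<in> Heis"
  by (auto simp: heis_def eigen_proj_eq_fourier lookup_single when_def fourier_in_eig zero_in_eig)

lemma mode_op_vacuum: "k \<ge> 0 \<Longrightarrow> mode \<alpha> k e = 0"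
  using heis_nonneg_vacuum[of "(0, Poly_Mapping.single k (eigen_proj hs \<nu> \<omega> p k \<alpha>))"] mode_in_heis
  by (simp add: mode_op_def heis_nonneg_def lookup_single when_def)

lemma mode_op_add: "mode \<alpha> k (v + w) = mode \<alpha> k v + mode \<alpha> k w"
  and mode_op_scale: "mode \<alpha> k (sv c v) = sv c (mode \<alpha> k v)"
  by (simp_all add: mode_op_def \<pi>_add \<pi>_scale mode_in_heis)

lemma mode_op_commute:
  "\<exists>c. mode \<alpha> k (mode \<beta> l v) = mode \<beta> l (mode \<alpha> k v) + sv c v \<and> (k + l \<noteq> 0 \<longrightarrow> c = 0)"
proof -
  let ?x = "(0, Poly_Mapping.single k (eigen_proj hs \<nu> \<omega> p k \<alpha>)) :: 'h heis"
  let ?y = "(0, Poly_Mapping.single l (eigen_proj hs \<nu> \<omega> p l \<beta>)) :: 'h heis"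
  define c where "c = fst (hbr ?x ?y)"
  have "hbr ?x ?y = (c, 0)" by (simp add: c_def heis_bracket_def)
  then have "mode \<alpha> k (mode \<beta> l v) - mode \<beta> l (mode \<alpha> k v) = sv c v"
    using \<pi>_bracket[OF mode_in_heis mode_in_heis, of k \<alpha> l \<beta> v]
    by (simp add: mode_op_def \<pi>_central)
  moreover have "c = 0" if "k + l \<noteq> 0"
    using that by (auto simp: c_def heis_bracket_def lookup_single when_def form.zero)
  ultimately show ?thesis by (intro exI[of _ c]) (auto simp: algebra_simps)
qed

text \<open>Creation monomials of degree M/p, where the pair (k, q) stands for q(-k/p). There are
  none for negative \<open>M\<close>.\<close>

definition fock :: "int \<Rightarrow> 'v set" where
  "fock M = {foldr (\<lambda>(k, q). mode q (- k)) xs e | xs.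
     set xs \<subseteq> {1..} \<times> Q \<and> sum_list (map fst xs) = M}"

definition fock_space :: "int \<Rightarrow> 'v set" where
  "fock_space M = V.span (fock M)"

text \<open>Every part is at least 1, so \<open>M\<close> bounds both the parts and their
  number.\<close>

lemma fock_space_finite: "finite (fock M)"
proof -
  let ?X = "{xs. set xs \<subseteq> {1..M} \<times> Q \<and> length xs \<le> nat M}"
  have "set xs \<subseteq> {1..M} \<times> Q \<and> length xs \<le> nat M \<and> M \<ge> 0"
    if "set xs \<subseteq> {1..} \<times> Q" "sum_list (map fst xs) = M" for xs :: "(int \<times> 'h) list" and M
    using that
  proof (induction xs arbitrary: M)
    case (Cons x xs)
    from Cons.IH[OF _ refl] Cons.prems show ?case by fastforce
  qed simp
  then have "fock M \<subseteq> (\<lambda>xs. foldr (\<lambda>(k, q). mode q (- k)) xs e) ` ?X"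
    unfolding fock_def by blast
  then show ?thesis
    by (rule finite_subset) (intro finite_imageI finite_lists_length_le finite_cartesian_product
      finite_atLeastAtMost_int H.finite_Basis)
qed

lemma fock_space_subspace: "V.subspace (fock_space M)"
  by (simp add: fock_space_def)

lemma e_in_fock_space: "e \<in> fock_space 0"
  unfolding fock_space_def fock_def by (rule V.span_base) (auto intro!: exI[of _ "[]"])

lemma mode_op_span:
  assumes "\<And>w. w \<in> S \<Longrightarrow> mode \<alpha> k w \<in> fock_space M" "v \<in> V.span S"
  shows "mode \<alpha> k v \<in> fock_space M"
proof -
  have "V.subspace {v. mode \<alpha> k v \<in> fock_space M}"
    using mode_op_scale[of \<alpha> k 0 0] fock_space_subspace[of M]
    by (intro V.subspaceI) (auto simp: mode_op_add mode_op_scale V.subspace_add V.subspace_scale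
        V.subspace_0)
  then show ?thesis using assms V.span_minimal[of S "{v. mode \<alpha> k v \<in> fock_space M}"] by blast
qed

lemma mode_op_neg_fock_space:
  assumes "q \<in> Q" "k < 0" "v \<in> fock_space M"
  shows "mode q k v \<in> fock_space (M - k)"
proof (rule mode_op_span[OF _ assms(3)[unfolded fock_space_def]])
  fix w assume "w \<in> fock M"
  then obtain xs where "set xs \<subseteq> {1..} \<times> Q" "sum_list (map fst xs) = M"
    "w = foldr (\<lambda>(k, q). mode q (- k)) xs e" by (auto simp: fock_def)
  then have "mode q k w \<in> fock (M - k)"
    unfolding fock_def using assms by (intro CollectI exI[of _ "(- k, q) # xs"]) auto
  then show "mode q k w \<in> fock_space (M - k)" unfolding fock_space_def by (rule V.span_base)
qed

text \<open>The mode is commuted to the right until it kills \<open>e\<close>; each commutator is a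
  scalar that respects the degree.\<close>

lemma mode_op_nonneg_fock_space:
  assumes "k \<ge> 0" "v \<in> fock_space M"
  shows "mode \<alpha> k v \<in> fock_space (M - k)"
proof (rule mode_op_span[OF _ assms(2)[unfolded fock_space_def]])
  fix w assume "w \<in> fock M"
  then obtain xs where "set xs \<subseteq> {1..} \<times> Q" "sum_list (map fst xs) = M"
    "w = foldr (\<lambda>(k, q). mode q (- k)) xs e" by (auto simp: fock_def)
  then show "mode \<alpha> k w \<in> fock_space (M - k)"
  proof (induction xs arbitrary: w M)
    case Nil
    then show ?case
      using mode_op_vacuum[OF assms(1)] V.subspace_0[OF fock_space_subspace] by simp
  next
    case (Cons x xs)
    obtain l q where x: "x = (l, q)" "l > 0" "q \<in> Q" using Cons.prems(1) by (cases x) auto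
    define u where "u = foldr (\<lambda>(k, q). mode q (- k)) xs e"
    have u: "u \<in> fock_space (M - l)"
      unfolding fock_space_def fock_def
      by (rule V.span_base) (use Cons.prems x u_def in auto)
    have "mode \<alpha> k u \<in> fock_space (M - l - k)"
      by (rule Cons.IH) (use Cons.prems x u_def in auto)
    then have "mode q (- l) (mode \<alpha> k u) \<in> fock_space (M - k)"
      using mode_op_neg_fock_space[OF x(3), of "- l"] x(2) by fastforce
    moreover obtain c where c: "mode \<alpha> k (mode q (- l) u) = mode q (- l) (mode \<alpha> k u) + sv c u"
      "k + - l \<noteq> 0 \<longrightarrow> c = 0"
      using mode_op_commute by blast
    \<comment> \<open>Dropping the factor of mode \<open>- l\<close> lowers the degree by
      \<open>l\<close>, which is right for \<open>k = l\<close>; otherwise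
      \<open>c = 0\<close>.\<close>
    moreover have "sv c u \<in> fock_space (M - k)"
      using u c(2) V.subspace_scale[OF fock_space_subspace] V.subspace_0[OF fock_space_subspace]
      by (cases "k = l") auto
    ultimately show ?case
      using Cons.prems(3) x u_def V.subspace_add[OF fock_space_subspace] by simp
  qed
qed

lemma mode_op_fock_space:
  "q \<in> Q \<Longrightarrow> v \<in> fock_space M \<Longrightarrow> mode q k v \<in> fock_space (M - k)"
  using mode_op_neg_fock_space mode_op_nonneg_fock_space by (cases "k < 0") auto

lemma normal_ordered_fock_space:
  assumes "q \<in> Q" "v \<in> fock_space M" "k + l = m"
  shows "normal_ordered hs \<nu> p \<omega> \<pi> q k q l v \<in> fock_space (M - m)"
  using mode_op_fock_space[OF assms(1) mode_op_fock_space[OF assms(1,2), of l], of k]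
    mode_op_fock_space[OF assms(1) mode_op_fock_space[OF assms(1,2), of k], of l] assms(3)
  by (auto simp: normal_ordered_def algebra_simps)

text \<open>In each quadratic term the modes add up to \<open>int p * n\<close>. The scalar term
  occurs only for \<open>n = 0\<close>, where the degree is unchanged.\<close>

lemma twisted_L_fock_space:
  assumes "v \<in> fock_space M"
  shows "twisted_L hs \<nu> p \<omega> Q sv \<pi> n r1 r2 v \<in> fock_space (M - int p * n)"
proof -
  note S = fock_space_subspace
  have "sv c v \<in> fock_space (M - int p * n)" if "n \<noteq> 0 \<Longrightarrow> c = 0" for c
    using that assms V.subspace_scale[OF S] V.subspace_0[OF S] by (cases "n = 0") auto
  moreover have "(\<Sum>\<alpha>\<in>Q. Sum_any (\<lambda>k::int. sv (c k)
      (normal_ordered hs \<nu> p \<omega> \<pi> \<alpha> k \<alpha> (int p * n - k) v))) \<in> fock_space (M - int p * n)" for c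
    by (intro V.subspace_sum[OF S] V.Sum_any_in_subspace[OF S] V.subspace_scale[OF S]
        normal_ordered_fock_space assms) auto
  ultimately show ?thesis
    unfolding twisted_L_def
    by (intro V.subspace_scale[OF S, of _ _ "fact r1 * fact r2"] V.subspace_diff[OF S]
        V.subspace_scale[OF S, of _ _ "1 / 2"]) auto
qed

subsection \<open>The action of the central extension\<close>

lemma \<rho>_module: "lie_module dhat_scale dhat_bracket dhat_plus sv UNIV \<rho>"
  and \<rho>_L: "\<rho> (dhat_L n r) v = twisted_L hs \<nu> p \<omega> Q sv \<pi> n r r v"
  and \<rho>_c: "\<rho> dhat_c v = sv (of_nat (H.dim UNIV)) v"
  using twisted_action by (simp_all add: twisted_action_def)

lemma \<rho>_plus: "x \<in> dhat_plus \<Longrightarrow> y \<in> dhat_plus \<Longrightarrow> \<rho> (x + y) v = \<rho> x v + \<rho> y v"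
  and \<rho>_dhat_scale: "x \<in> dhat_plus \<Longrightarrow> \<rho> (dhat_scale c x) v = sv c (\<rho> x v)"
  and \<rho>_dhat_bracket: "x \<in> dhat_plus \<Longrightarrow> y \<in> dhat_plus \<Longrightarrow>
    \<rho> (dhat_bracket x y) v = \<rho> x (\<rho> y v) - \<rho> y (\<rho> x v)"
  using \<rho>_module by (simp_all add: lie_module_def)

lemma in_dhat_plus: "(z, a) \<in> dhat_plus \<longleftrightarrow> a \<in> D_plus"
  by (simp add: dhat_plus_def)

lemma dhat_c_in_dhat_plus: "dhat_c \<in> dhat_plus"
  by (simp add: dhat_c_def in_dhat_plus D_plus.zero)

lemma dhat_scale_pair: "dhat_scale z (c, a) = (z * c, diffop_scale z a)"
  by (simp add: dhat_scale_def)

lemma diffop_scale_zero: "diffop_scale z 0 = 0"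
  by (rule poly_mapping_eqI) (simp add: lookup_diffop_scale)

lemma \<rho>_pair:
  assumes "a \<in> D_plus"
  shows "\<rho> (z, a) v = \<rho> (0, a) v + sv (z * of_nat (H.dim UNIV)) v"
proof -
  have "dhat_scale z dhat_c \<in> dhat_plus"
    by (simp add: dhat_c_def dhat_scale_pair in_dhat_plus diffop_scale_zero D_plus.zero)
  then have "\<rho> ((0, a) + dhat_scale z dhat_c) v = \<rho> (0, a) v + sv z (\<rho> dhat_c v)"
    using assms by (simp only: \<rho>_plus in_dhat_plus \<rho>_dhat_scale dhat_c_in_dhat_plus)
  moreover have "(0, a) + dhat_scale z dhat_c = (z, a)"
    by (simp add: dhat_c_def dhat_scale_pair diffop_scale_zero)
  ultimately show ?thesis by (simp add: \<rho>_c)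
qed

lemma \<rho>_add:
  assumes "a \<in> D_plus" "b \<in> D_plus"
  shows "\<rho> (0, a + b) v = \<rho> (0, a) v + \<rho> (0, b) v"
  using \<rho>_plus[of "(0, a)" "(0, b)"] assms by (simp add: in_dhat_plus)

lemma \<rho>_scale: "a \<in> D_plus \<Longrightarrow> \<rho> (0, diffop_scale c a) v = sv c (\<rho> (0, a) v)"
  using \<rho>_dhat_scale[of "(0, a)"] by (simp add: in_dhat_plus dhat_scale_pair)

lemma \<rho>_zero: "\<rho> (0, 0) v = 0"
  using \<rho>_add[OF D_plus.zero D_plus.zero, of v] by simp

lemma \<rho>_bracket:
  assumes "a \<in> D_plus" "b \<in> D_plus"
  shows "\<rho> (0, diffop_bracket a b) v =
    \<rho> (0, a) (\<rho> (0, b) v) - \<rho> (0, b) (\<rho> (0, a) v) + sv (1 / 2 * Psi a b * of_nat (H.dim UNIV)) v"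
proof -
  define c where "c = 1 / 2 * Psi a b * of_nat (H.dim UNIV)"
  have "dhat_bracket (0, a) (0, b) = (- (1 / 2) * Psi a b, diffop_bracket a b)"
    by (simp add: dhat_bracket_def)
  then have "\<rho> (0, a) (\<rho> (0, b) v) - \<rho> (0, b) (\<rho> (0, a) v) =
      \<rho> (- (1 / 2) * Psi a b, diffop_bracket a b) v"
    using \<rho>_dhat_bracket[of "(0, a)" "(0, b)" v] assms by (simp only: in_dhat_plus)
  also have "\<dots> = \<rho> (0, diffop_bracket a b) v + sv (- c) v"
    unfolding \<rho>_pair[OF D_plus.bracket[OF assms], of "- (1 / 2) * Psi a b"] c_def by simp
  finally show ?thesis unfolding c_def[symmetric] by (simp add: algebra_simps)
qed

text \<open>The degree is measured by the action on the Fock grading. Membership in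
  \<open>D_plus\<close> is included because the module laws for \<open>\<rho>\<close> are available
  only there.\<close>

definition homogeneous :: "int \<Rightarrow> diffop \<Rightarrow> bool" where
  "homogeneous n a \<longleftrightarrow> a \<in> D_plus \<and>
     (\<forall>M. \<forall>v\<in>fock_space M. \<rho> (0, a) v \<in> fock_space (M - int p * n))"

lemma homogeneous_zero: "homogeneous n 0"
  by (simp add: homogeneous_def D_plus.zero \<rho>_zero V.subspace_0[OF fock_space_subspace])

lemma homogeneous_add: "homogeneous n a \<Longrightarrow> homogeneous n b \<Longrightarrow> homogeneous n (a + b)"
  by (simp add: homogeneous_def D_plus.add \<rho>_add V.subspace_add[OF fock_space_subspace])

lemma homogeneous_scale: "homogeneous n a \<Longrightarrow> homogeneous n (diffop_scale c a)"
  by (simp add: homogeneous_def D_plus.scale \<rho>_scale V.subspace_scale[OF fock_space_subspace])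

lemma homogeneous_sum: "(\<And>i. i \<in> I \<Longrightarrow> homogeneous n (f i)) \<Longrightarrow> homogeneous n (\<Sum>i\<in>I. f i)"
  by (induction I rule: infinite_finite_induct) (simp_all add: homogeneous_zero homogeneous_add)

lemma Psi_component: "m + n \<noteq> 0 \<Longrightarrow> Psi (component m a) (component n b) = 0"
  by (auto simp: Psi_def component_def Psi_term_def)

text \<open>The cocycle contributes a scalar, which preserves the degree; it vanishes unless
  \<open>m + n = 0\<close>.\<close>

lemma homogeneous_bracket:
  assumes a: "homogeneous m (component m a)" and b: "homogeneous n (component n b)"
  shows "homogeneous (m + n) (diffop_bracket (component m a) (component n b))"
  unfolding homogeneous_def
proof (intro conjI allI ballI)
  let ?a = "component m a" and ?b = "component n b"
  have D: "?a \<in> D_plus" "?b \<in> D_plus" using a b by (auto simp: homogeneous_def)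
  then show "diffop_bracket ?a ?b \<in> D_plus" by (rule D_plus.bracket)
  fix M v assume v: "v \<in> fock_space M"
  note S = fock_space_subspace
  have "\<rho> (0, ?b) v \<in> fock_space (M - int p * n)" "\<rho> (0, ?a) v \<in> fock_space (M - int p * m)"
    using a b v by (auto simp: homogeneous_def)
  then have "\<rho> (0, ?a) (\<rho> (0, ?b) v) \<in> fock_space (M - int p * n - int p * m)"
    "\<rho> (0, ?b) (\<rho> (0, ?a) v) \<in> fock_space (M - int p * m - int p * n)"
    using a b by (auto simp: homogeneous_def)
  moreover have "M - int p * n - int p * m = M - int p * (m + n)"
    "M - int p * m - int p * n = M - int p * (m + n)" by (simp_all add: algebra_simps)
  moreover have "sv (1 / 2 * Psi ?a ?b * of_nat (H.dim UNIV)) v \<in> fock_space (M - int p * (m + n))"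
    using v V.subspace_scale[OF S] V.subspace_0[OF S]
    by (cases "m + n = 0") (simp_all add: Psi_component)
  ultimately show "\<rho> (0, diffop_bracket ?a ?b) v \<in> fock_space (M - int p * (m + n))"
    unfolding \<rho>_bracket[OF D] by (intro V.subspace_add[OF S] V.subspace_diff[OF S]) simp_all
qed

text \<open>Induction on the generation of \<open>D_plus\<close>, for all degrees at once: a
  component of a bracket involves components of every degree of both factors.\<close>

lemma D_plus_homogeneous_component: "a \<in> D_plus \<Longrightarrow> homogeneous n (component n a)"
proof (induction arbitrary: n rule: D_plus.induct)
  case (gen m r)
  have "homogeneous m (L_gen m r)"
    using twisted_L_fock_space \<rho>_L[of m r] by (simp add: homogeneous_def D_plus.gen dhat_L_def)
  then show ?case by (simp add: component_L_gen homogeneous_zero)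
next
  case (bracket a b)
  obtain I where "component n (diffop_bracket a b) =
      (\<Sum>m\<in>I. diffop_bracket (component m a) (component (n - m) b))"
    by (rule component_diffop_bracket)
  moreover have "homogeneous n (diffop_bracket (component m a) (component (n - m) b))" for m
    using homogeneous_bracket[OF bracket.IH(1)[of m] bracket.IH(2)[of "n - m"]] by simp
  ultimately show ?case by (simp add: homogeneous_sum)
qed (simp_all add: component_add component_scale homogeneous_add homogeneous_scale,
     simp add: component_def homogeneous_zero)

lemma degree_fock_space:
  assumes x: "x \<in> dhat_plus_degree n" and v: "v \<in> fock_space M"
  shows "\<rho> x v \<in> fock_space (M - int p * n)"
proof -
  obtain z a where za: "x = (z, a)" "a \<in> D_plus" "Poly_Mapping.keys a \<subseteq> {n}" "n \<noteq> 0 \<Longrightarrow> z = 0"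
    using x by (cases x) (auto simp: dhat_plus_degree_def dhat_plus_def)
  have "component n a = a"
    using za(3) by (intro poly_mapping_eqI) (auto simp: component_def lookup_single when_def in_keys_iff)
  then have "homogeneous n a" using D_plus_homogeneous_component[OF za(2), of n] by simp
  then have "\<rho> (0, a) v \<in> fock_space (M - int p * n)" using v by (simp add: homogeneous_def)
  moreover have "sv (z * of_nat (H.dim UNIV)) v \<in> fock_space (M - int p * n)"
    using za(4) v V.subspace_scale[OF fock_space_subspace] V.subspace_0[OF fock_space_subspace]
    by (cases "n = 0") auto
  ultimately show ?thesis
    unfolding za(1) \<rho>_pair[OF za(2), of z] by (rule V.subspace_add[OF fock_space_subspace])
qed

text \<open>Elements of degree \<open>n\<close> lower the Fock degree by \<open>int p * n\<close>,
  which places degree \<open>k\<close> in a single finite-dimensional piece.\<close>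

lemma homogeneous_subspace_fock_space:
  "homogeneous_subspace sv \<rho> e k \<subseteq> fock_space (- (int p * k))"
proof -
  have "foldr \<rho> (map fst xs) e \<in> fock_space (- (int p * sum_list (map snd xs)))"
    if "\<forall>(x, n)\<in>set xs. x \<in> dhat_plus_degree n" for xs :: "(dhat \<times> int) list"
    using that
  proof (induction xs)
    case Nil
    then show ?case by (simp add: e_in_fock_space)
  next
    case (Cons x xs)
    then have "\<rho> (fst x) (foldr \<rho> (map fst xs) e) \<in>
        fock_space (- (int p * sum_list (map snd xs)) - int p * snd x)"
      by (intro degree_fock_space) auto
    moreover have "- (int p * sum_list (map snd xs)) - int p * snd x =
        - (int p * (snd x + sum_list (map snd xs)))" by (simp add: distrib_left)
    ultimately show ?case by simp
  qed
  then show ?thesis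
    unfolding homogeneous_subspace_def by (intro V.span_minimal fock_space_subspace) auto
qed

section \<open>The weights of the vacuum vector\<close>

lemma mode_op_zero: "mode \<alpha> k 0 = 0"
  using mode_op_scale[of \<alpha> k 0 0] by simp

text \<open>The mode applied first is nonnegative: it is \<open>k\<close> if \<open>k > 0\<close>,
  and otherwise \<open>int p * n - k\<close>.\<close>

lemma normal_ordered_vacuum:
  assumes "n \<ge> 0"
  shows "normal_ordered hs \<nu> p \<omega> \<pi> \<alpha> k \<alpha> (int p * n - k) e = 0"
proof -
  have "int p * n \<ge> 0" using assms by simp
  then show ?thesis by (auto simp: normal_ordered_def mode_op_vacuum mode_op_zero)
qed

abbreviation "char_series \<equiv> \<Sum>k<p. (fps_exp (of_nat k / of_nat p) - 1) *
  of_nat (H.dim (eig (int k))) / (1 - fps_exp (1 :: complex))"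

text \<open>Only the scalar term survives on \<open>e\<close>, and its minus sign cancels that of
  the diagonal coefficient.\<close>

lemma twisted_L_vacuum:
  assumes "n \<ge> 0"
  shows "twisted_L hs \<nu> p \<omega> Q sv \<pi> n r r e =
    (if n = 0 then sv ((- 1) ^ r * (fact (2 * r + 1) / 2 * fps_nth char_series (2 * r + 1))) e else 0)"
proof -
  define x where "x = 1 / 2 * fps_nth (fps_nth (fps_deriv (subst_diff char_series)) r) r"
  have x: "fact r * fact r * x = - ((- 1) ^ r * (fact (2 * r + 1) / 2 * fps_nth char_series (2 * r + 1)))"
    unfolding x_def by (rule subst_diff_deriv_diagonal)
  have "twisted_L hs \<nu> p \<omega> Q sv \<pi> n r r e = - sv (if n = 0 then fact r * fact r * x else 0) e"
    unfolding twisted_L_def x_def[symmetric] by (simp add: normal_ordered_vacuum[OF assms])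
  then show ?thesis
    unfolding x
    by (simp only: V.scale_minus_left V.scale_zero_left minus_minus minus_zero split: if_split) simp
qed

lemma quasi_finite_highest_weight:
  "quasi_finite_highest_weight_module sv (enveloping_orbit dhat_plus sv \<rho> e) \<rho> e"
  unfolding quasi_finite_highest_weight_module_def highest_weight_module_def
proof (intro conjI allI impI refl)
  show "lie_module dhat_scale dhat_bracket dhat_plus sv (enveloping_orbit dhat_plus sv \<rho> e) \<rho>"
    by (rule enveloping_orbit_lie_module[OF \<rho>_module])
  show "e \<in> enveloping_orbit dhat_plus sv \<rho> e"
    unfolding enveloping_orbit_def by (rule V.span_base) (auto intro!: exI[of _ "[]"])
  show "\<exists>E. finite E \<and> homogeneous_subspace sv \<rho> e k \<subseteq> V.span E" for k
    using homogeneous_subspace_fock_space fock_space_finite unfolding fock_space_def by blast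
  show "\<exists>z. \<rho> dhat_c e = sv z e" using \<rho>_c by blast
  show "\<exists>z. \<rho> (dhat_L 0 r) e = sv z e" for r
    unfolding \<rho>_L twisted_L_vacuum[OF order.refl] by (simp only: simp_thms if_True) blast
qed (simp_all add: e_nonzero \<rho>_L twisted_L_vacuum)

lemma weight_functional_value:
  assumes "weight_functional sv \<rho> e \<delta>"
  shows "\<delta> (dhat_L 0 k) = fact (2 * k + 1) / 2 * fps_nth char_series (2 * k + 1)"
proof -
  have "sv ((- 1) ^ k * \<delta> (dhat_L 0 k)) e =
      sv ((- 1) ^ k * (fact (2 * k + 1) / 2 * fps_nth char_series (2 * k + 1))) e"
    using assms twisted_L_vacuum[of 0 k] \<rho>_L[of 0 k e] by (simp add: weight_functional_def)
  then show ?thesis using e_nonzero by (simp add: V.scale_cancel_right)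
qed

lemma weight_functional_exists: "\<exists>\<delta>. weight_functional sv \<rho> e \<delta>"
proof -
  \<comment> \<open>The value wanted on the i-th power of D. For \<open>i = 2 * k + 1\<close> one
    has \<open>i div 2 = k\<close>, and the sign undoes the one in \<open>L_gen 0 k\<close>.\<close>
  define c where "c i = (- 1) ^ (i div 2 + 1) *
    (fact (2 * (i div 2) + 1) / 2 * fps_nth char_series (2 * (i div 2) + 1))" for i
  define \<Phi> where "\<Phi> q = (\<Sum>i\<le>degree q. coeff q i * c i)" for q :: "complex poly"
  have \<Phi>: "\<Phi> q = (\<Sum>i\<le>n. coeff q i * c i)" if "degree q \<le> n" for q n
    unfolding \<Phi>_def
    by (rule sum.mono_neutral_left) (use that in \<open>auto simp: coeff_eq_0\<close>)
  have add: "\<Phi> (q + r) = \<Phi> q + \<Phi> r" for q r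
  proof -
    let ?n = "max (degree q) (degree r)"
    have n: "degree (q + r) \<le> ?n" "degree q \<le> ?n" "degree r \<le> ?n"
      by (simp_all add: degree_add_le_max)
    show ?thesis unfolding n[THEN \<Phi>] by (simp add: distrib_right sum.distrib)
  qed
  have scale: "\<Phi> (smult a q) = a * \<Phi> q" for a q
    unfolding \<Phi>[OF degree_smult_le] \<Phi>_def[of q] sum_distrib_left by (simp only: coeff_smult mult.assoc)
  have mon: "\<Phi> (monom a n) = a * c n" for a n
    by (subst \<Phi>[OF degree_monom_le]) (simp add: if_distrib[of "\<lambda>x. x * _"] cong: if_cong)
  have "weight_functional sv \<rho> e (\<lambda>x. \<Phi> (Poly_Mapping.lookup (snd x) 0))"
    unfolding weight_functional_def Let_def
  proof (intro conjI ballI allI)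
    fix k
    have "Poly_Mapping.lookup (snd (dhat_L 0 k)) 0 = monom ((- 1) ^ (k + 1)) (2 * k + 1)"
      by (simp add: dhat_L_def L_gen_0)
    moreover have "(- 1) ^ (k + 1) * c (2 * k + 1) =
        fact (2 * k + 1) / 2 * fps_nth char_series (2 * k + 1)"
      by (simp add: c_def power_mult_distrib[symmetric] mult.assoc[symmetric] del: power_Suc fact_Suc)
    ultimately show "\<rho> (dhat_L 0 k) e =
        sv ((- 1) ^ k * \<Phi> (Poly_Mapping.lookup (snd (dhat_L 0 k)) 0)) e"
      by (simp only: \<rho>_L twisted_L_vacuum[OF order.refl] mon simp_thms if_True)
  qed (simp_all add: add scale lookup_add dhat_scale_def lookup_diffop_scale)
  then show ?thesis by blast
qed

text \<open>In degree 2k the derivative supplies the factor 2k+1 that turns (2k)! into (2k+1)!. In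
  odd degree \<open>Delta\<close> has no coefficient, and the other side vanishes by parity.\<close>

lemma Delta_eq:
  assumes "weight_functional sv \<rho> e \<delta>"
  shows "Delta \<delta> = fps_const (1 / 2) * fps_deriv char_series"
proof (rule fps_ext)
  fix n
  show "fps_nth (Delta \<delta>) n = fps_nth (fps_const (1 / 2) * fps_deriv char_series) n"
  proof (cases "even n")
    case True
    then obtain k where k: "n = 2 * k" by blast
    have "fact (2 * k + 1) = of_nat (2 * k + 1) * (fact (2 * k) :: complex)" by simp
    then show ?thesis
      by (simp add: Delta_def k weight_functional_value[OF assms] del: fact_Suc of_nat_Suc)
  next
    case False
    have "fps_nth char_series (n + 1) = 0"
      by (rule character_series_parity[OF p]) (use False dim_eig_minus in \<open>simp_all add: of_nat_diff\<close>)
    then show ?thesis using False by (simp add: Delta_def)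
  qed
qed

end

theorem corollary6p6:
  fixes hs :: "complex \<Rightarrow> 'h::ab_group_add \<Rightarrow> 'h"
    and form :: "'h \<Rightarrow> 'h \<Rightarrow> complex"
    and \<nu> :: "'h \<Rightarrow> 'h" and p :: nat and \<omega> :: complex
    and \<Lambda> Q :: "'h set"
    and sv :: "complex \<Rightarrow> 'v::ab_group_add \<Rightarrow> 'v"
    and \<pi> :: "'h heis \<Rightarrow> 'v \<Rightarrow> 'v" and e :: 'v
    and \<rho> :: "dhat \<Rightarrow> 'v \<Rightarrow> 'v"
  assumes "\<exists>E. finite_dimensional_vector_space hs E"
    and "nondegenerate_symmetric_form hs form"
    and "p > 0" and "isometry_of_period hs form \<nu> p"
    and "rational_lattice hs form \<Lambda>" and "\<nu> ` \<Lambda> = \<Lambda>"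
    and "primitive_root_of_unity p \<omega>"
    and "orthonormal_basis hs form Q"
    and "twisted_space hs form \<nu> p \<omega> sv \<pi> e"
    and "twisted_action hs \<nu> p \<omega> Q sv \<pi> \<rho>"
  shows "quasi_finite_highest_weight_module sv (enveloping_orbit dhat_plus sv \<rho> e) \<rho> e \<and>
    (\<exists>\<delta>. weight_functional sv \<rho> e \<delta>) \<and>
    (\<forall>\<delta>. weight_functional sv \<rho> e \<delta> \<longrightarrow>
       Delta \<delta> = fps_const (1 / 2) * fps_deriv
         (\<Sum>k<p. (fps_exp (of_nat k / of_nat p) - 1) *
                  of_nat (vector_space.dim hs (eigen_part hs \<nu> \<omega> (int k))) / (1 - fps_exp 1)))"
proof -
  interpret twisted_module hs form \<nu> p \<omega> Q sv \<pi> e \<rho>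
    by (unfold_locales) (fact assms)+
  show ?thesis
    using quasi_finite_highest_weight weight_functional_exists Delta_eq by blast
qed

end
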